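(* Let $G$ be a finite perfect multiplicative Lie algebra with $\tilde M(G)=1$. Then: (i) $H^2_{ML}(G,A)=1$ for every abelian group $A$ regarded as a multiplicative Lie algebra with trivial product; (ii) if $N$ is a central ideal of $G$, then $N\cong\tilde M(G/N)$ and $G$ is a cover of $G/N$.
   Context: A multiplicative Lie algebra is a triple $(G,\cdot,\star)$ where $(G,\cdot)$ is a group (not necessarily abelian) and $\star$ is a binary operation on $G$ such that for all $x,y,z\in G$, writing ${}^xy=xyx^{-1}$: (1) $x\star x=1$; (2) $x\star(yz)=(x\star y)\,{}^y(x\star z)$; (3) $(xy)\star z={}^x(y\star z)\,(x\star z)$; (4) $((x\star y)\star{}^yz)((y\star z)\star{}^zx)((z\star x)\star{}^xy)=1$; (5) ${}^z(x\star y)={}^zx\star{}^zy$. The trivial product is $x\star y=1$ for all $x,y$. An ideal is a normal subgroup $H$ with $x\star y\in H$ for all $x\in G$, $y\in H$; quotients by ideals are multiplicative Lie algebras. Homomorphisms are group homomorphisms preserving $\star$. For ideals $A,B$ of a multiplicative Lie algebra, at least one of which is the whole algebra, ${}^M[A,B]=(A\star B)[A,B]$, where $A\star B$ (resp. $[A,B]$) is the subgroup generated by all $a\star b$ (resp. $[a,b]=aba^{-1}b^{-1}$), $a\in A$, $b\in B$; it is an ideal. $G$ is perfect if ${}^M[G,G]=G$. $Z(G)$ is the group center, $LZ(G)=\{x\in G: x\star y=1\ \forall y\in G\}$, $\mathcal{Z}(G)=LZ(G)\cap Z(G)$; a central ideal is an ideal contained in $\mathcal{Z}(G)$. The Schur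 multiplier of $G$ is $\tilde M(G)=({}^M[F,F]\cap R)/{}^M[R,F]$ for any free presentation $1\to R\to F\to G\to1$ (short exact sequence of multiplicative Lie algebras with $F$ a free multiplicative Lie algebra on a set); it is independent of the presentation up to isomorphism. A central extension $1\to N\to G^*\to G\to1$ is a short exact sequence of multiplicative Lie algebras with $N\subseteq\mathcal{Z}(G^* )$. It is a stem extension if $N\subseteq{}^M[G^*,G^*]$, and a stem cover if in addition $N\cong\tilde M(G)$; in that case $G^*$ is called a cover of $G$. Let $A$ be an abelian group with trivial product. A multiplicative Lie 2-cocycle of $G$ with coefficients in $A$ is a pair $(f,h)$ of maps $G\times G\to A$ with $f(x,1)=f(1,x)=1$ such that the set $A\times G$ with operations $(a,x)\cdot(b,y)=(ab\,f(x,y),xy)$ and $(a,x)\star(b,y)=(h(x,y),x\star y)$ is a multiplicative Lie algebra (so that it is a central extension of $G$ by $A$). These pairs form an abelian group $Z^2_{ML}(G,A)$ under pointwise multiplication. The coboundaries $B^2_{ML}(G,A)$ are the pairs of the form $f(x,y)=g(x)g(y)g(xy)^{-1}$, $h(x,y)=g(x\star y)^{-1}$ for a map $g:G\to A$ with $g(1)=1$. Then $H^2_{ML}(G,A)=Z^2_{ML}(G,A)/B^2_{ML}(G,A)$. *)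

theory Defs
  imports "HOL-Algebra.Algebra"
begin

section \<open>Multiplicative Lie algebras\<close>

record 'a mla = "'a monoid" +
  star :: "'a \<Rightarrow> 'a \<Rightarrow> 'a" (infixl \<open>\<star>\<index>\<close> 70)

definition conj_by :: "('a, 'm) monoid_scheme \<Rightarrow> 'a \<Rightarrow> 'a \<Rightarrow> 'a" where
  "conj_by G x y = x \<otimes>\<^bsub>G\<^esub> y \<otimes>\<^bsub>G\<^esub> inv\<^bsub>G\<^esub> x"

locale mult_lie_algebra = group G for G :: "'a mla" (structure) +
  assumes star_closed [intro, simp]:
    "\<lbrakk>x \<in> carrier G; y \<in> carrier G\<rbrakk> \<Longrightarrow> x \<star> y \<in> carrier G"
  and star_self:
    "x \<in> carrier G \<Longrightarrow> x \<star> x = \<one>"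
  and star_mult_right:
    "\<lbrakk>x \<in> carrier G; y \<in> carrier G; z \<in> carrier G\<rbrakk>
      \<Longrightarrow> x \<star> (y \<otimes> z) = (x \<star> y) \<otimes> conj_by G y (x \<star> z)"
  and star_mult_left:
    "\<lbrakk>x \<in> carrier G; y \<in> carrier G; z \<in> carrier G\<rbrakk>
      \<Longrightarrow> (x \<otimes> y) \<star> z = conj_by G x (y \<star> z) \<otimes> (x \<star> z)"
  and star_jacobi:
    "\<lbrakk>x \<in> carrier G; y \<in> carrier G; z \<in> carrier G\<rbrakk>
      \<Longrightarrow> ((x \<star> y) \<star> conj_by G y z) \<otimes> ((y \<star> z) \<star> conj_by G z x)
            \<otimes> ((z \<star> x) \<star> conj_by G x y) = \<one>"
  and conj_star:
    "\<lbrakk>x \<in> carrier G; y \<in> carrier G; z \<in> carrier G\<rbrakk>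
      \<Longrightarrow> conj_by G z (x \<star> y) = conj_by G z x \<star> conj_by G z y"

definition mla_hom :: "'a mla \<Rightarrow> 'b mla \<Rightarrow> ('a \<Rightarrow> 'b) set" where
  "mla_hom G H = {h \<in> hom G H. \<forall>x \<in> carrier G. \<forall>y \<in> carrier G.
      h (x \<star>\<^bsub>G\<^esub> y) = h x \<star>\<^bsub>H\<^esub> h y}"

definition mla_iso :: "'a mla \<Rightarrow> 'b mla \<Rightarrow> bool" (infix \<open>\<cong>\<^sub>M\<close> 60) where
  "G \<cong>\<^sub>M H \<longleftrightarrow> (\<exists>h \<in> mla_hom G H. bij_betw h (carrier G) (carrier H))"

definition mla_ideal :: "'a set \<Rightarrow> 'a mla \<Rightarrow> bool" where
  "mla_ideal H G \<longleftrightarrow> H \<lhd> G \<and> (\<forall>x \<in> carrier G. \<forall>y \<in> H. x \<star>\<^bsub>G\<^esub> y \<in> H)"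

definition sub_mla :: "'a mla \<Rightarrow> 'a set \<Rightarrow> 'a mla" where
  "sub_mla G H = G\<lparr>carrier := H\<rparr>"

text \<open>For an ideal \<open>H\<close> the union defining the star product of two cosets is a single coset.\<close>

definition quot_mla :: "'a mla \<Rightarrow> 'a set \<Rightarrow> 'a set mla" where
  "quot_mla G H =
     \<lparr>carrier = rcosets\<^bsub>G\<^esub> H, monoid.mult = set_mult G, one = H,
      star = (\<lambda>S T. \<Union>x\<in>S. \<Union>y\<in>T. H #>\<^bsub>G\<^esub> (x \<star>\<^bsub>G\<^esub> y))\<rparr>"

definition star_span :: "'a mla \<Rightarrow> 'a set \<Rightarrow> 'a set \<Rightarrow> 'a set" where
  "star_span G A B = generate G {a \<star>\<^bsub>G\<^esub> b | a b. a \<in> A \<and> b \<in> B}"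

definition commutator_span :: "'a mla \<Rightarrow> 'a set \<Rightarrow> 'a set \<Rightarrow> 'a set" where
  "commutator_span G A B =
     generate G {a \<otimes>\<^bsub>G\<^esub> b \<otimes>\<^bsub>G\<^esub> inv\<^bsub>G\<^esub> a \<otimes>\<^bsub>G\<^esub> inv\<^bsub>G\<^esub> b | a b. a \<in> A \<and> b \<in> B}"

text \<open>The ideal \<open>\<^sup>M[A,B] = (A \<star> B)[A,B]\<close>.\<close>

definition mla_commutator :: "'a mla \<Rightarrow> 'a set \<Rightarrow> 'a set \<Rightarrow> 'a set" where
  "mla_commutator G A B = star_span G A B <#>\<^bsub>G\<^esub> commutator_span G A B"

definition mla_perfect :: "'a mla \<Rightarrow> bool" where
  "mla_perfect G \<longleftrightarrow> mla_commutator G (carrier G) (carrier G) = carrier G"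

definition group_center :: "'a mla \<Rightarrow> 'a set" where
  "group_center G = {x \<in> carrier G. \<forall>y \<in> carrier G. x \<otimes>\<^bsub>G\<^esub> y = y \<otimes>\<^bsub>G\<^esub> x}"

definition lie_center :: "'a mla \<Rightarrow> 'a set" where
  "lie_center G = {x \<in> carrier G. \<forall>y \<in> carrier G. x \<star>\<^bsub>G\<^esub> y = \<one>\<^bsub>G\<^esub>}"

definition mla_center :: "'a mla \<Rightarrow> 'a set" where
  "mla_center G = lie_center G \<inter> group_center G"

definition central_ideal :: "'a set \<Rightarrow> 'a mla \<Rightarrow> bool" where
  "central_ideal N G \<longleftrightarrow> mla_ideal N G \<and> N \<subseteq> mla_center G"


section \<open>Free multiplicative Lie algebras\<close>

text \<open>
  The free multiplicative Lie algebra on a set \<open>V\<close> is the algebra of terms with generators in \<open>V\<close>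
  modulo the least congruence containing all instances of the axioms.  That this is the
  free object is shown below (\<open>mult_lie_algebra_free_mla\<close>, \<open>free_mla_universal\<close>).
\<close>

datatype 'x mla_term =
    Gen 'x
  | One
  | Inv "'x mla_term"
  | Mul "'x mla_term" "'x mla_term"
  | Star "'x mla_term" "'x mla_term"

definition terms_over :: "'x set \<Rightarrow> 'x mla_term set" where
  "terms_over V = {t. set_mla_term t \<subseteq> V}"

abbreviation Conj :: "'x mla_term \<Rightarrow> 'x mla_term \<Rightarrow> 'x mla_term" where
  "Conj s t \<equiv> Mul (Mul s t) (Inv s)"

inductive term_eq :: "'x set \<Rightarrow> 'x mla_term \<Rightarrow> 'x mla_term \<Rightarrow> bool" for V where
  refl: "s \<in> terms_over V \<Longrightarrow> term_eq V s s"
| sym: "term_eq V s t \<Longrightarrow> term_eq V t s"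
| trans: "\<lbrakk>term_eq V s t; term_eq V t u\<rbrakk> \<Longrightarrow> term_eq V s u"
| cong_Inv: "term_eq V s s' \<Longrightarrow> term_eq V (Inv s) (Inv s')"
| cong_Mul: "\<lbrakk>term_eq V s s'; term_eq V t t'\<rbrakk> \<Longrightarrow> term_eq V (Mul s t) (Mul s' t')"
| cong_Star: "\<lbrakk>term_eq V s s'; term_eq V t t'\<rbrakk> \<Longrightarrow> term_eq V (Star s t) (Star s' t')"
| assoc: "\<lbrakk>s \<in> terms_over V; t \<in> terms_over V; u \<in> terms_over V\<rbrakk>
    \<Longrightarrow> term_eq V (Mul (Mul s t) u) (Mul s (Mul t u))"
| l_one: "s \<in> terms_over V \<Longrightarrow> term_eq V (Mul One s) s"
| l_inv: "s \<in> terms_over V \<Longrightarrow> term_eq V (Mul (Inv s) s) One"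
| star_self: "s \<in> terms_over V \<Longrightarrow> term_eq V (Star s s) One"
| star_mult_right: "\<lbrakk>s \<in> terms_over V; t \<in> terms_over V; u \<in> terms_over V\<rbrakk>
    \<Longrightarrow> term_eq V (Star s (Mul t u)) (Mul (Star s t) (Conj t (Star s u)))"
| star_mult_left: "\<lbrakk>s \<in> terms_over V; t \<in> terms_over V; u \<in> terms_over V\<rbrakk>
    \<Longrightarrow> term_eq V (Star (Mul s t) u) (Mul (Conj s (Star t u)) (Star s u))"
| jacobi: "\<lbrakk>s \<in> terms_over V; t \<in> terms_over V; u \<in> terms_over V\<rbrakk>
    \<Longrightarrow> term_eq V (Mul (Mul (Star (Star s t) (Conj t u)) (Star (Star t u) (Conj u s)))
                       (Star (Star u s) (Conj s t))) One"
| conj_star: "\<lbrakk>s \<in> terms_over V; t \<in> terms_over V; u \<in> terms_over V\<rbrakk>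
    \<Longrightarrow> term_eq V (Conj u (Star s t)) (Star (Conj u s) (Conj u t))"

definition term_class :: "'x set \<Rightarrow> 'x mla_term \<Rightarrow> 'x mla_term set" where
  "term_class V s = {t. term_eq V s t}"

definition free_mla :: "'x set \<Rightarrow> 'x mla_term set mla" where
  "free_mla V =
     \<lparr>carrier = term_class V ` terms_over V,
      monoid.mult = (\<lambda>S T. \<Union>s\<in>S. \<Union>t\<in>T. term_class V (Mul s t)),
      one = term_class V One,
      star = (\<lambda>S T. \<Union>s\<in>S. \<Union>t\<in>T. term_class V (Star s t))\<rparr>"

primrec eval_term :: "'a mla \<Rightarrow> ('x \<Rightarrow> 'a) \<Rightarrow> 'x mla_term \<Rightarrow> 'a" where
  "eval_term G \<phi> (Gen x) = \<phi> x"
| "eval_term G \<phi> One = \<one>\<^bsub>G\<^esub>"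
| "eval_term G \<phi> (Inv s) = inv\<^bsub>G\<^esub> (eval_term G \<phi> s)"
| "eval_term G \<phi> (Mul s t) = eval_term G \<phi> s \<otimes>\<^bsub>G\<^esub> eval_term G \<phi> t"
| "eval_term G \<phi> (Star s t) = eval_term G \<phi> s \<star>\<^bsub>G\<^esub> eval_term G \<phi> t"

text \<open>The homomorphism on the free algebra induced by a map \<open>\<phi>\<close> on generators; \<open>eval_term\<close> is
  constant on equivalence classes, so the image below is a singleton.\<close>

definition free_lift :: "'a mla \<Rightarrow> ('x \<Rightarrow> 'a) \<Rightarrow> 'x mla_term set \<Rightarrow> 'a" where
  "free_lift G \<phi> S = the_elem (eval_term G \<phi> ` S)"

lemma terms_over_simps [simp]:
  "Gen x \<in> terms_over V \<longleftrightarrow> x \<in> V"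
  "One \<in> terms_over V"
  "Inv s \<in> terms_over V \<longleftrightarrow> s \<in> terms_over V"
  "Mul s t \<in> terms_over V \<longleftrightarrow> s \<in> terms_over V \<and> t \<in> terms_over V"
  "Star s t \<in> terms_over V \<longleftrightarrow> s \<in> terms_over V \<and> t \<in> terms_over V"
  by (auto simp: terms_over_def)

lemma term_class_self: "s \<in> terms_over V \<Longrightarrow> s \<in> term_class V s"
  by (simp add: term_class_def term_eq.refl)

lemma term_class_eqI: "term_eq V s t \<Longrightarrow> term_class V s = term_class V t"
  unfolding term_class_def by (blast intro: term_eq.sym term_eq.trans)

lemma term_class_UN:
  assumes "s \<in> terms_over V" "t \<in> terms_over V"
    and "\<And>s' t'. \<lbrakk>term_eq V s s'; term_eq V t t'\<rbrakk> \<Longrightarrow> term_eq V (h s t) (h s' t')"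
  shows "(\<Union>s'\<in>term_class V s. \<Union>t'\<in>term_class V t. term_class V (h s' t')) = term_class V (h s t)"
proof -
  have "term_class V (h s' t') = term_class V (h s t)"
    if "s' \<in> term_class V s" "t' \<in> term_class V t" for s' t'
    using term_class_eqI[OF assms(3)] that unfolding term_class_def by simp
  then have "(\<Union>s'\<in>term_class V s. \<Union>t'\<in>term_class V t. term_class V (h s' t')) =
      (\<Union>s'\<in>term_class V s. \<Union>t'\<in>term_class V t. term_class V (h s t))"
    by (intro SUP_cong) (rule HOL.refl | assumption)+
  also have "\<dots> = term_class V (h s t)"
    using assms(1,2)[THEN term_class_self] by blast
  finally show ?thesis .
qed

lemma free_mla_mult:
  "\<lbrakk>s \<in> terms_over V; t \<in> terms_over V\<rbrakk>
    \<Longrightarrow> term_class V s \<otimes>\<^bsub>free_mla V\<^esub> term_class V t = term_class V (Mul s t)"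
  by (simp add: free_mla_def term_class_UN term_eq.cong_Mul)

lemma free_mla_star:
  "\<lbrakk>s \<in> terms_over V; t \<in> terms_over V\<rbrakk>
    \<Longrightarrow> term_class V s \<star>\<^bsub>free_mla V\<^esub> term_class V t = term_class V (Star s t)"
  by (simp add: free_mla_def term_class_UN term_eq.cong_Star)

lemma free_mla_one: "\<one>\<^bsub>free_mla V\<^esub> = term_class V One"
  by (simp add: free_mla_def)

lemma free_mla_carrier: "carrier (free_mla V) = term_class V ` terms_over V"
  by (simp add: free_mla_def)

lemma free_mla_class_closed: "s \<in> terms_over V \<Longrightarrow> term_class V s \<in> carrier (free_mla V)"
  by (simp add: free_mla_carrier)

lemma group_free_mla: "group (free_mla V)"
proof (rule groupI)
  fix x y z
  assume "x \<in> carrier (free_mla V)" "y \<in> carrier (free_mla V)" "z \<in> carrier (free_mla V)"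
  then obtain s t u where [simp]: "s \<in> terms_over V" "t \<in> terms_over V" "u \<in> terms_over V"
    "x = term_class V s" "y = term_class V t" "z = term_class V u"
    by (auto simp: free_mla_carrier)
  show "x \<otimes>\<^bsub>free_mla V\<^esub> y \<otimes>\<^bsub>free_mla V\<^esub> z =
      x \<otimes>\<^bsub>free_mla V\<^esub> (y \<otimes>\<^bsub>free_mla V\<^esub> z)"
    by (simp add: free_mla_mult term_class_eqI[OF term_eq.assoc])
next
  fix x y
  assume "x \<in> carrier (free_mla V)" "y \<in> carrier (free_mla V)"
  then obtain s t where [simp]: "s \<in> terms_over V" "t \<in> terms_over V"
    "x = term_class V s" "y = term_class V t"
    by (auto simp: free_mla_carrier)
  show "x \<otimes>\<^bsub>free_mla V\<^esub> y \<in> carrier (free_mla V)"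
    by (simp add: free_mla_mult free_mla_class_closed)
next
  fix x
  assume "x \<in> carrier (free_mla V)"
  then obtain s where [simp]: "s \<in> terms_over V" "x = term_class V s"
    by (auto simp: free_mla_carrier)
  show "\<one>\<^bsub>free_mla V\<^esub> \<otimes>\<^bsub>free_mla V\<^esub> x = x"
    by (simp add: free_mla_one free_mla_mult term_class_eqI[OF term_eq.l_one])
  show "\<exists>y\<in>carrier (free_mla V). y \<otimes>\<^bsub>free_mla V\<^esub> x = \<one>\<^bsub>free_mla V\<^esub>"
    by (rule bexI[of _ "term_class V (Inv s)"])
      (simp_all add: free_mla_one free_mla_mult free_mla_class_closed term_class_eqI[OF term_eq.l_inv])
qed (simp add: free_mla_one free_mla_class_closed)

lemma free_mla_inv:
  assumes "s \<in> terms_over V"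
  shows "inv\<^bsub>free_mla V\<^esub> (term_class V s) = term_class V (Inv s)"
  using assms
  by (intro group.inv_equality[OF group_free_mla])
    (simp_all add: free_mla_one free_mla_mult free_mla_class_closed term_class_eqI[OF term_eq.l_inv])

theorem mult_lie_algebra_free_mla: "mult_lie_algebra (free_mla V)"
proof (intro mult_lie_algebra.intro mult_lie_algebra_axioms.intro group_free_mla)
  fix x y z
  assume "x \<in> carrier (free_mla V)" "y \<in> carrier (free_mla V)" "z \<in> carrier (free_mla V)"
  then obtain s t u where [simp]: "s \<in> terms_over V" "t \<in> terms_over V" "u \<in> terms_over V"
    "x = term_class V s" "y = term_class V t" "z = term_class V u"
    by (auto simp: free_mla_carrier)
  note [simp] = conj_by_def free_mla_mult free_mla_star free_mla_inv free_mla_one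
  show "x \<star>\<^bsub>free_mla V\<^esub> (y \<otimes>\<^bsub>free_mla V\<^esub> z) =
      (x \<star>\<^bsub>free_mla V\<^esub> y) \<otimes>\<^bsub>free_mla V\<^esub> conj_by (free_mla V) y (x \<star>\<^bsub>free_mla V\<^esub> z)"
    using term_class_eqI[OF term_eq.star_mult_right[of s V t u]] by simp
  show "(x \<otimes>\<^bsub>free_mla V\<^esub> y) \<star>\<^bsub>free_mla V\<^esub> z =
      conj_by (free_mla V) x (y \<star>\<^bsub>free_mla V\<^esub> z) \<otimes>\<^bsub>free_mla V\<^esub> (x \<star>\<^bsub>free_mla V\<^esub> z)"
    using term_class_eqI[OF term_eq.star_mult_left[of s V t u]] by simp
  show "((x \<star>\<^bsub>free_mla V\<^esub> y) \<star>\<^bsub>free_mla V\<^esub> conj_by (free_mla V) y z)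
      \<otimes>\<^bsub>free_mla V\<^esub> ((y \<star>\<^bsub>free_mla V\<^esub> z) \<star>\<^bsub>free_mla V\<^esub> conj_by (free_mla V) z x)
      \<otimes>\<^bsub>free_mla V\<^esub> ((z \<star>\<^bsub>free_mla V\<^esub> x) \<star>\<^bsub>free_mla V\<^esub> conj_by (free_mla V) x y) = \<one>\<^bsub>free_mla V\<^esub>"
    using term_class_eqI[OF term_eq.jacobi[of s V t u]] by simp
  show "conj_by (free_mla V) z (x \<star>\<^bsub>free_mla V\<^esub> y) =
      conj_by (free_mla V) z x \<star>\<^bsub>free_mla V\<^esub> conj_by (free_mla V) z y"
    using term_class_eqI[OF term_eq.conj_star[of s V t u]] by simp
next
  fix x y
  assume "x \<in> carrier (free_mla V)" "y \<in> carrier (free_mla V)"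
  then obtain s t where [simp]: "s \<in> terms_over V" "t \<in> terms_over V"
    "x = term_class V s" "y = term_class V t"
    by (auto simp: free_mla_carrier)
  show "x \<star>\<^bsub>free_mla V\<^esub> y \<in> carrier (free_mla V)"
    by (simp add: free_mla_star free_mla_class_closed)
  show "x \<star>\<^bsub>free_mla V\<^esub> x = \<one>\<^bsub>free_mla V\<^esub>"
    by (simp add: free_mla_one free_mla_star term_class_eqI[OF term_eq.star_self])
qed

context mult_lie_algebra
begin

lemma eval_term_closed:
  assumes "\<phi> \<in> V \<rightarrow> carrier G" and "s \<in> terms_over V"
  shows "eval_term G \<phi> s \<in> carrier G"
  using assms(2) by (induction s) (use assms(1) in auto)

lemma eval_term_eq:
  assumes "\<phi> \<in> V \<rightarrow> carrier G" and "term_eq V s t"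
  shows "eval_term G \<phi> s = eval_term G \<phi> t"
proof -
  note ax = star_mult_right star_mult_left star_jacobi conj_star
  note cl = eval_term_closed[OF assms(1)]
  show ?thesis
    using assms(2)
  proof (induction rule: term_eq.induct)
    case (star_mult_right s t u)
    then show ?case using ax(1)[OF cl cl cl, of s t u] by (simp add: conj_by_def)
  next
    case (star_mult_left s t u)
    then show ?case using ax(2)[OF cl cl cl, of s t u] by (simp add: conj_by_def)
  next
    case (jacobi s t u)
    then show ?case using ax(3)[OF cl cl cl, of s t u] by (simp add: conj_by_def)
  next
    case (conj_star s t u)
    then show ?case using ax(4)[OF cl cl cl, of s t u] by (simp add: conj_by_def)
  qed (auto simp: cl m_assoc star_self)
qed

lemma free_lift_class:
  assumes "\<phi> \<in> V \<rightarrow> carrier G" and "s \<in> terms_over V"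
  shows "free_lift G \<phi> (term_class V s) = eval_term G \<phi> s"
proof -
  have "eval_term G \<phi> ` term_class V s = {eval_term G \<phi> s}"
  proof (intro equalityI subsetI)
    fix a assume "a \<in> eval_term G \<phi> ` term_class V s"
    then obtain t where "term_eq V s t" "a = eval_term G \<phi> t"
      by (auto simp: term_class_def)
    then show "a \<in> {eval_term G \<phi> s}"
      using eval_term_eq[OF assms(1), of s t] by simp
  qed (use term_class_self[OF assms(2)] in blast)
  then show ?thesis by (simp add: free_lift_def)
qed

theorem free_mla_universal:
  assumes \<phi>: "\<phi> \<in> V \<rightarrow> carrier G"
  shows "free_lift G \<phi> \<in> mla_hom (free_mla V) G"
    and "x \<in> V \<Longrightarrow> free_lift G \<phi> (term_class V (Gen x)) = \<phi> x"
    and "\<lbrakk>h \<in> mla_hom (free_mla V) G; \<And>x. x \<in> V \<Longrightarrow> h (term_class V (Gen x)) = \<phi> x;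
          a \<in> carrier (free_mla V)\<rbrakk> \<Longrightarrow> h a = free_lift G \<phi> a"
proof -
  show "free_lift G \<phi> \<in> mla_hom (free_mla V) G"
    by (auto simp: mla_hom_def hom_def free_mla_carrier free_mla_mult free_mla_star
        free_lift_class[OF \<phi>] eval_term_closed[OF \<phi>])
  show "x \<in> V \<Longrightarrow> free_lift G \<phi> (term_class V (Gen x)) = \<phi> x"
    by (simp add: free_lift_class[OF \<phi>])
  assume h: "h \<in> mla_hom (free_mla V) G"
    and gen: "\<And>x. x \<in> V \<Longrightarrow> h (term_class V (Gen x)) = \<phi> x"
    and a: "a \<in> carrier (free_mla V)"
  interpret F: group "free_mla V" by (rule group_free_mla)
  interpret H: group_hom "free_mla V" G h
    using h by unfold_locales (auto simp: mla_hom_def)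
  have "h (term_class V s) = eval_term G \<phi> s" if "s \<in> terms_over V" for s
    using that
  proof (induction s)
    case One
    then show ?case using H.hom_one by (simp add: free_mla_one)
  next
    case (Inv s)
    then have "h (inv\<^bsub>free_mla V\<^esub> (term_class V s)) = inv (h (term_class V s))"
      by (intro H.hom_inv free_mla_class_closed) simp
    with Inv show ?case by (simp add: free_mla_inv)
  next
    case (Mul s t)
    then have "h (term_class V s \<otimes>\<^bsub>free_mla V\<^esub> term_class V t) =
        h (term_class V s) \<otimes> h (term_class V t)"
      by (intro H.hom_mult free_mla_class_closed) simp_all
    with Mul show ?case by (simp add: free_mla_mult)
  next
    case (Star s t)
    then have "h (term_class V s \<star>\<^bsub>free_mla V\<^esub> term_class V t) =
        h (term_class V s) \<star> h (term_class V t)"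
      using h by (simp add: mla_hom_def free_mla_class_closed)
    with Star show ?case by (simp add: free_mla_star)
  qed (simp add: gen)
  with a show "h a = free_lift G \<phi> a"
    by (auto simp: free_mla_carrier free_lift_class[OF \<phi>])
qed

end


section \<open>Schur multiplier and covers\<close>

definition presentation_multiplier :: "'f mla \<Rightarrow> 'f set \<Rightarrow> 'f set mla" where
  "presentation_multiplier F R =
     quot_mla (sub_mla F (mla_commutator F (carrier F) (carrier F) \<inter> R))
              (mla_commutator F R (carrier F))"

text \<open>
  The multiplier does not depend on the free presentation up to isomorphism; we use the canonical
  one, in which \<open>F\<close> is free on the underlying set of \<open>G\<close> and \<open>F \<rightarrow> G\<close> extends the identity.
\<close>

definition schur_multiplier :: "'a mla \<Rightarrow> 'a mla_term set set mla" where
  "schur_multiplier G =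
     (let F = free_mla (carrier G) in
        presentation_multiplier F (kernel F G (free_lift G (\<lambda>x. x))))"

text \<open>\<open>central_extension N E p G\<close>: the sequence \<open>1 \<rightarrow> N \<rightarrow> E \<rightarrow> G \<rightarrow> 1\<close>, where \<open>N\<close> is a subset of
  \<open>E\<close>, the first map is the inclusion and the second is \<open>p\<close>, is a central extension.\<close>

definition central_extension :: "'a set \<Rightarrow> 'a mla \<Rightarrow> ('a \<Rightarrow> 'b) \<Rightarrow> 'b mla \<Rightarrow> bool" where
  "central_extension N E p G \<longleftrightarrow>
     mult_lie_algebra E \<and> mult_lie_algebra G \<and> p \<in> mla_hom E G \<and>
     p ` carrier E = carrier G \<and> kernel E G p = N \<and> N \<subseteq> mla_center E"

definition stem_extension :: "'a set \<Rightarrow> 'a mla \<Rightarrow> ('a \<Rightarrow> 'b) \<Rightarrow> 'b mla \<Rightarrow> bool" where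
  "stem_extension N E p G \<longleftrightarrow>
     central_extension N E p G \<and> N \<subseteq> mla_commutator E (carrier E) (carrier E)"

definition stem_cover :: "'a set \<Rightarrow> 'a mla \<Rightarrow> ('a \<Rightarrow> 'b) \<Rightarrow> 'b mla \<Rightarrow> bool" where
  "stem_cover N E p G \<longleftrightarrow> stem_extension N E p G \<and> sub_mla E N \<cong>\<^sub>M schur_multiplier G"

definition mla_cover :: "'a mla \<Rightarrow> 'b mla \<Rightarrow> bool" where
  "mla_cover E G \<longleftrightarrow> (\<exists>N p. stem_cover N E p G)"


section \<open>Second cohomology with trivial-product coefficients\<close>

definition ext_mla ::
    "'a mla \<Rightarrow> 'c monoid \<Rightarrow> ('a \<times> 'a \<Rightarrow> 'c) \<Rightarrow> ('a \<times> 'a \<Rightarrow> 'c) \<Rightarrow> ('c \<times> 'a) mla" where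
  "ext_mla G A f h =
     \<lparr>carrier = carrier A \<times> carrier G,
      monoid.mult = (\<lambda>(a, x) (b, y). (a \<otimes>\<^bsub>A\<^esub> b \<otimes>\<^bsub>A\<^esub> f (x, y), x \<otimes>\<^bsub>G\<^esub> y)),
      one = (\<one>\<^bsub>A\<^esub>, \<one>\<^bsub>G\<^esub>),
      star = (\<lambda>(a, x) (b, y). (h (x, y), x \<star>\<^bsub>G\<^esub> y))\<rparr>"

text \<open>Cochains are functions on \<open>carrier G \<times> carrier G\<close>, represented as extensional functions so
  that they are determined by their values there.\<close>

definition ml_cocycles ::
    "'a mla \<Rightarrow> 'c monoid \<Rightarrow> (('a \<times> 'a \<Rightarrow> 'c) \<times> ('a \<times> 'a \<Rightarrow> 'c)) set" where
  "ml_cocycles G A =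
     {(f, h). f \<in> carrier G \<times> carrier G \<rightarrow>\<^sub>E carrier A \<and>
              h \<in> carrier G \<times> carrier G \<rightarrow>\<^sub>E carrier A \<and>
              (\<forall>x \<in> carrier G. f (x, \<one>\<^bsub>G\<^esub>) = \<one>\<^bsub>A\<^esub> \<and> f (\<one>\<^bsub>G\<^esub>, x) = \<one>\<^bsub>A\<^esub>) \<and>
              mult_lie_algebra (ext_mla G A f h)}"

definition ml_Z2 ::
    "'a mla \<Rightarrow> 'c monoid \<Rightarrow> (('a \<times> 'a \<Rightarrow> 'c) \<times> ('a \<times> 'a \<Rightarrow> 'c)) monoid" where
  "ml_Z2 G A =
     \<lparr>carrier = ml_cocycles G A,
      monoid.mult = (\<lambda>(f, h) (f', h').
        (\<lambda>u \<in> carrier G \<times> carrier G. f u \<otimes>\<^bsub>A\<^esub> f' u,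
         \<lambda>u \<in> carrier G \<times> carrier G. h u \<otimes>\<^bsub>A\<^esub> h' u)),
      one = (\<lambda>u \<in> carrier G \<times> carrier G. \<one>\<^bsub>A\<^esub>, \<lambda>u \<in> carrier G \<times> carrier G. \<one>\<^bsub>A\<^esub>)\<rparr>"

definition ml_coboundary ::
    "'a mla \<Rightarrow> 'c monoid \<Rightarrow> ('a \<Rightarrow> 'c) \<Rightarrow> ('a \<times> 'a \<Rightarrow> 'c) \<times> ('a \<times> 'a \<Rightarrow> 'c)" where
  "ml_coboundary G A g =
     (\<lambda>(x, y) \<in> carrier G \<times> carrier G. g x \<otimes>\<^bsub>A\<^esub> g y \<otimes>\<^bsub>A\<^esub> inv\<^bsub>A\<^esub> g (x \<otimes>\<^bsub>G\<^esub> y),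
      \<lambda>(x, y) \<in> carrier G \<times> carrier G. inv\<^bsub>A\<^esub> g (x \<star>\<^bsub>G\<^esub> y))"

definition ml_B2 ::
    "'a mla \<Rightarrow> 'c monoid \<Rightarrow> (('a \<times> 'a \<Rightarrow> 'c) \<times> ('a \<times> 'a \<Rightarrow> 'c)) set" where
  "ml_B2 G A =
     ml_coboundary G A ` {g. g \<in> carrier G \<rightarrow> carrier A \<and> g \<one>\<^bsub>G\<^esub> = \<one>\<^bsub>A\<^esub>}"

definition ml_H2 ::
    "'a mla \<Rightarrow> 'c monoid \<Rightarrow> (('a \<times> 'a \<Rightarrow> 'c) \<times> ('a \<times> 'a \<Rightarrow> 'c)) set monoid" where
  "ml_H2 G A = ml_Z2 G A Mod ml_B2 G A"

end

theory Submission
  imports Defs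
begin

text \<open>
  Let \<open>F\<close> be the free algebra on \<open>G\<close> and \<open>R\<close> the kernel of \<open>F \<rightarrow> G\<close>.  Triviality of the multiplier
  says \<open>\<^sup>M[F,F] \<inter> R \<subseteq> \<^sup>M[R,F]\<close>.  This transfers to every surjection \<open>p : H \<rightarrow> G\<close> with kernel \<open>K\<close>: lift
  \<open>F \<rightarrow> G\<close> to \<open>\<phi> : F \<rightarrow> H\<close>; as \<open>H = \<phi>(F) K\<close>, an element \<open>x\<close> of \<open>\<^sup>M[H,H]\<close> is \<open>w \<phi>(v)\<close> with
  \<open>w \<in> \<^sup>M[K,H]\<close> and \<open>v \<in> \<^sup>M[F,F]\<close>, and if \<open>p x = 1\<close> then \<open>v \<in> R\<close>, whence
  \<open>\<^sup>M[H,H] \<inter> K \<subseteq> \<^sup>M[K,H]\<close>.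

  If \<open>K\<close> is central, \<open>p\<close> therefore maps \<open>\<^sup>M[H,H]\<close> bijectively onto the perfect algebra \<open>G\<close>, and the
  inverse is a section; applied to the extension defined by a cocycle, the section exhibits the
  cocycle as a coboundary.  For a central ideal \<open>N\<close>, let \<open>F'\<close> be the free algebra on \<open>G/N\<close> with
  relators \<open>R'\<close>, and lift \<open>F' \<rightarrow> G/N\<close> to \<open>\<psi> : F' \<rightarrow> G\<close>, which is onto because \<open>G\<close> is perfect and \<open>N\<close>
  central.  Then \<open>\<psi>\<close> maps \<open>\<^sup>M[F',F'] \<inter> R'\<close> onto \<open>N\<close>, and the transferred inclusion for \<open>p = \<psi>\<close>
  shows that the kernel of this map is \<open>\<^sup>M[R',F']\<close>.
\<close>

section \<open>Commutator ideals under homomorphisms\<close>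

lemma (in group) normal_carrier: "carrier G \<lhd> G"
  by (simp add: normal_inv_iff subgroup_self)

lemma (in group) inv_mult_cancel:
  assumes "x \<in> carrier G" "y \<in> carrier G"
  shows "inv x \<otimes> (x \<otimes> y) = y" "x \<otimes> (inv x \<otimes> y) = y"
  using assms by (simp_all add: m_assoc[symmetric])

lemma (in group_hom) hom_commute:
  assumes "x \<in> carrier G" "y \<in> carrier G"
    and "h (x \<otimes> y \<otimes> inv x \<otimes> inv y) = \<one>\<^bsub>H\<^esub>"
  shows "h x \<otimes>\<^bsub>H\<^esub> h y = h y \<otimes>\<^bsub>H\<^esub> h x"
proof -
  have "h x \<otimes>\<^bsub>H\<^esub> h y \<otimes>\<^bsub>H\<^esub> inv\<^bsub>H\<^esub> (h y \<otimes>\<^bsub>H\<^esub> h x) = \<one>\<^bsub>H\<^esub>"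
    using assms by (simp add: H.inv_mult_group H.m_assoc)
  then show ?thesis
    using assms(1,2) H.inv_solve_right[of "\<one>\<^bsub>H\<^esub>" "h x \<otimes>\<^bsub>H\<^esub> h y" "h y \<otimes>\<^bsub>H\<^esub> h x"] by simp
qed

text \<open>The commutator is the quotient of \<open>x k y l\<close> by \<open>y l x k\<close>.
  Since \<open>h k\<close> and \<open>h l\<close> commute with the whole image of \<open>h\<close>,
  both move to the right end of each product and cancel there.\<close>

lemma (in group_hom) commutator_hom_cong:
  assumes cl: "x \<in> carrier G" "y \<in> carrier G" "k \<in> carrier G" "l \<in> carrier G"
    and k: "\<And>z. z \<in> carrier G \<Longrightarrow> h k \<otimes>\<^bsub>H\<^esub> h z = h z \<otimes>\<^bsub>H\<^esub> h k"
    and l: "\<And>z. z \<in> carrier G \<Longrightarrow> h l \<otimes>\<^bsub>H\<^esub> h z = h z \<otimes>\<^bsub>H\<^esub> h l"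
  shows "h ((x \<otimes> k) \<otimes> (y \<otimes> l) \<otimes> inv (x \<otimes> k) \<otimes> inv (y \<otimes> l)) = h (x \<otimes> y \<otimes> inv x \<otimes> inv y)"
proof -
  have e1: "h (x \<otimes> k \<otimes> (y \<otimes> l)) = h x \<otimes>\<^bsub>H\<^esub> h y \<otimes>\<^bsub>H\<^esub> (h k \<otimes>\<^bsub>H\<^esub> h l)"
    using k[of "y \<otimes> l"] l[of k] cl by (simp add: H.m_assoc)
  have e2: "h (y \<otimes> l \<otimes> (x \<otimes> k)) = h y \<otimes>\<^bsub>H\<^esub> h x \<otimes>\<^bsub>H\<^esub> (h k \<otimes>\<^bsub>H\<^esub> h l)"
    using l[of "x \<otimes> k"] cl by (simp add: H.m_assoc)
  have "h ((x \<otimes> k) \<otimes> (y \<otimes> l) \<otimes> inv (x \<otimes> k) \<otimes> inv (y \<otimes> l))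
      = h (x \<otimes> k \<otimes> (y \<otimes> l)) \<otimes>\<^bsub>H\<^esub> inv\<^bsub>H\<^esub> h (y \<otimes> l \<otimes> (x \<otimes> k))"
    using cl by (simp add: H.inv_mult_group H.m_assoc)
  also have "\<dots> = h (x \<otimes> y \<otimes> inv x \<otimes> inv y)"
    unfolding e1 e2 using cl by (simp add: H.inv_mult_group H.m_assoc H.inv_mult_cancel)
  finally show ?thesis .
qed

lemma conj_by_one_hom:
  assumes "group G" "group Q" "q \<in> hom G Q" "x \<in> carrier G" "y \<in> carrier G" "q y = \<one>\<^bsub>Q\<^esub>"
  shows "q (conj_by G x y) = \<one>\<^bsub>Q\<^esub>"
proof -
  interpret group_hom G Q q
    using assms by (simp add: group_hom_def group_hom_axioms_def)
  show ?thesis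
    using assms by (simp add: conj_by_def)
qed

section \<open>Star product identities and generators of \<open>mla_commutator\<close>\<close>

context mult_lie_algebra
begin

lemma conj_by_closed [simp]:
  "x \<in> carrier G \<Longrightarrow> y \<in> carrier G \<Longrightarrow> conj_by G x y \<in> carrier G"
  by (simp add: conj_by_def)

text \<open>Expand the star square of \<open>x \<otimes> y\<close>, which is trivial, first in the
  left and then in the right argument. The squares of \<open>x\<close> and \<open>y\<close> vanish,
  and a conjugate by \<open>x\<close> of the claimed product remains.\<close>

lemma star_swap:
  assumes x: "x \<in> carrier G" and y: "y \<in> carrier G"
  shows "(y \<star> x) \<otimes> (x \<star> y) = \<one>"
proof -
  have "x \<otimes> ((y \<star> x) \<otimes> (x \<star> y)) \<otimes> inv x = (x \<otimes> y) \<star> (x \<otimes> y)"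
    unfolding star_mult_left[OF x y m_closed[OF x y]] star_mult_right[OF y x y]
      star_mult_right[OF x x y]
    using x y by (simp add: star_self conj_by_def m_assoc inv_mult_cancel)
  also have "\<dots> = \<one>"
    using x y by (simp add: star_self)
  finally have "x \<otimes> ((y \<star> x) \<otimes> (x \<star> y)) = x"
    using x y inv_solve_right[of \<one> "x \<otimes> ((y \<star> x) \<otimes> (x \<star> y))" x] by simp
  then show ?thesis
    using x y by simp
qed

lemma star_swap_inv:
  assumes "x \<in> carrier G" "y \<in> carrier G"
  shows "y \<star> x = inv (x \<star> y)"
  using inv_equality[OF star_swap[OF assms]] assms by simp

lemma one_star [simp]:
  assumes "y \<in> carrier G" shows "\<one> \<star> y = \<one>"
  using star_mult_left[of \<one> \<one> y] assms by (simp add: conj_by_def)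

text \<open>Distributivity splits off only conjugates of \<open>k \<star> e\<close> and
  \<open>x \<star> l\<close>, which \<open>q\<close> kills, the latter by antisymmetry. As
  \<open>Q\<close> is merely a group, this applies before a quotient is known to carry a star
  product.\<close>

lemma star_hom_cong:
  assumes Q: "group Q" and q: "q \<in> hom G Q" and K: "K \<subseteq> carrier G"
    and kill: "\<And>k e. k \<in> K \<Longrightarrow> e \<in> carrier G \<Longrightarrow> q (k \<star> e) = \<one>\<^bsub>Q\<^esub>"
    and x: "x \<in> carrier G" and y: "y \<in> carrier G" and k: "k \<in> K" and l: "l \<in> K"
  shows "q ((x \<otimes> k) \<star> (y \<otimes> l)) = q (x \<star> y)"
proof -
  note G = group_axioms
  interpret group_hom G Q q
    using G Q q by (simp add: group_hom_def group_hom_axioms_def)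
  have kl: "k \<in> carrier G" "l \<in> carrier G"
    using K k l by auto
  have xl: "q (x \<star> l) = \<one>\<^bsub>Q\<^esub>"
    using kill[OF l x] star_swap_inv[of l x] x kl by simp
  have "q ((x \<otimes> k) \<star> (y \<otimes> l)) = q (x \<star> (y \<otimes> l))"
    using x y kl kill[OF k, of "y \<otimes> l"]
    by (simp add: star_mult_left conj_by_one_hom[OF G Q q])
  also have "\<dots> = q (x \<star> y)"
    using x y kl xl by (simp add: star_mult_right conj_by_one_hom[OF G Q q])
  finally show ?thesis .
qed

lemma star_span_gens: "A \<subseteq> carrier G \<Longrightarrow> B \<subseteq> carrier G \<Longrightarrow> {a \<star> b | a b. a \<in> A \<and> b \<in> B} \<subseteq> carrier G"
  by blast

lemma commutator_span_gens:
  "A \<subseteq> carrier G \<Longrightarrow> B \<subseteq> carrier G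
    \<Longrightarrow> {a \<otimes> b \<otimes> inv a \<otimes> inv b | a b. a \<in> A \<and> b \<in> B} \<subseteq> carrier G"
  by blast

lemma mla_commutator_star:
  assumes "A \<subseteq> carrier G" "B \<subseteq> carrier G" "a \<in> A" "b \<in> B"
  shows "a \<star> b \<in> mla_commutator G A B"
proof -
  have "a \<star> b \<in> star_span G A B"
    unfolding star_span_def using assms by (blast intro: generate.incl)
  moreover have "\<one> \<in> commutator_span G A B"
    unfolding commutator_span_def by (rule generate.one)
  ultimately have "(a \<star> b) \<otimes> \<one> \<in> mla_commutator G A B"
    unfolding mla_commutator_def set_mult_def by blast
  moreover have "a \<star> b \<in> carrier G"
    using assms by blast
  ultimately show ?thesis
    by simp
qed

lemma mla_commutator_comm:
  assumes "A \<subseteq> carrier G" "B \<subseteq> carrier G" "a \<in> A" "b \<in> B"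
  shows "a \<otimes> b \<otimes> inv a \<otimes> inv b \<in> mla_commutator G A B"
proof -
  let ?c = "a \<otimes> b \<otimes> inv a \<otimes> inv b"
  have "?c \<in> commutator_span G A B"
    unfolding commutator_span_def using assms by (blast intro: generate.incl)
  moreover have "\<one> \<in> star_span G A B"
    unfolding star_span_def by (rule generate.one)
  ultimately have "\<one> \<otimes> ?c \<in> mla_commutator G A B"
    unfolding mla_commutator_def set_mult_def by blast
  moreover have "?c \<in> carrier G"
    using assms by blast
  ultimately show ?thesis
    by simp
qed

text \<open>Serves as the induction principle for \<open>mla_commutator\<close>: it reduces
  inclusions to the two kinds of generators.\<close>

lemma mla_commutator_least:
  assumes "A \<subseteq> carrier G" "B \<subseteq> carrier G" "subgroup H G"
    and "\<And>a b. a \<in> A \<Longrightarrow> b \<in> B \<Longrightarrow> a \<star> b \<in> H"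
    and "\<And>a b. a \<in> A \<Longrightarrow> b \<in> B \<Longrightarrow> a \<otimes> b \<otimes> inv a \<otimes> inv b \<in> H"
  shows "mla_commutator G A B \<subseteq> H"
proof -
  have "star_span G A B \<subseteq> H" "commutator_span G A B \<subseteq> H"
    unfolding star_span_def commutator_span_def
    by (rule generate_subgroup_incl[OF _ assms(3)]; use assms(4,5) in blast)+
  then show ?thesis
    unfolding mla_commutator_def set_mult_def using subgroup.m_closed[OF assms(3)] by blast
qed

text \<open>Conjugation permutes the star generators by \<open>conj_star\<close>, and the group
  commutators by being an automorphism. So both spans are normal, and hence their product.\<close>

lemma normal_mla_commutator:
  assumes "A \<lhd> G" "B \<lhd> G"
  shows "mla_commutator G A B \<lhd> G"
proof -
  have sub: "A \<subseteq> carrier G" "B \<subseteq> carrier G"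
    using assms by (auto dest: normal_imp_subgroup subgroup.subset)
  have conjA: "\<And>a g. a \<in> A \<Longrightarrow> g \<in> carrier G \<Longrightarrow> g \<otimes> a \<otimes> inv g \<in> A"
    and conjB: "\<And>a g. a \<in> B \<Longrightarrow> g \<in> carrier G \<Longrightarrow> g \<otimes> a \<otimes> inv g \<in> B"
    using assms by (auto simp: normal_inv_iff)
  have "star_span G A B \<lhd> G"
    unfolding star_span_def
  proof (rule normal_generateI[OF star_span_gens[OF sub]])
    fix h g assume "h \<in> {a \<star> b | a b. a \<in> A \<and> b \<in> B}" and g: "g \<in> carrier G"
    then obtain a b where ab: "a \<in> A" "b \<in> B" "h = a \<star> b"
      by blast
    then have "g \<otimes> h \<otimes> inv g = (g \<otimes> a \<otimes> inv g) \<star> (g \<otimes> b \<otimes> inv g)"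
      using conj_star[of a b g] sub g by (auto simp: conj_by_def)
    then show "g \<otimes> h \<otimes> inv g \<in> {a \<star> b | a b. a \<in> A \<and> b \<in> B}"
      using conjA conjB ab g by blast
  qed
  moreover have "commutator_span G A B \<lhd> G"
    unfolding commutator_span_def
  proof (rule normal_generateI[OF commutator_span_gens[OF sub]])
    fix h g assume "h \<in> {a \<otimes> b \<otimes> inv a \<otimes> inv b | a b. a \<in> A \<and> b \<in> B}" and g: "g \<in> carrier G"
    then obtain a b where ab: "a \<in> A" "b \<in> B" "h = a \<otimes> b \<otimes> inv a \<otimes> inv b"
      by blast
    have abG: "a \<in> carrier G" "b \<in> carrier G"
      using ab sub by auto
    have "g \<otimes> h \<otimes> inv g = (g \<otimes> a \<otimes> inv g) \<otimes> (g \<otimes> b \<otimes> inv g)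
        \<otimes> inv (g \<otimes> a \<otimes> inv g) \<otimes> inv (g \<otimes> b \<otimes> inv g)"
      using abG g by (simp add: ab(3) inv_mult_group m_assoc inv_mult_cancel)
    then show "g \<otimes> h \<otimes> inv g \<in> {a \<otimes> b \<otimes> inv a \<otimes> inv b | a b. a \<in> A \<and> b \<in> B}"
      using conjA conjB ab g by blast
  qed
  ultimately show ?thesis
    unfolding mla_commutator_def by (rule normal_subgroup_set_mult_closed)
qed

lemma central_commutator_trivial:
  assumes "K \<subseteq> mla_center G"
  shows "mla_commutator G K (carrier G) \<subseteq> {\<one>}"
proof (rule mla_commutator_least)
  show "K \<subseteq> carrier G"
    using assms by (auto simp: mla_center_def lie_center_def)
  fix a b assume "a \<in> K" and b: "b \<in> carrier G"
  then have a: "a \<in> carrier G" "a \<star> b = \<one>" "a \<otimes> b = b \<otimes> a"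
    using assms by (auto simp: mla_center_def lie_center_def group_center_def)
  show "a \<star> b \<in> {\<one>}"
    by (simp add: a)
  show "a \<otimes> b \<otimes> inv a \<otimes> inv b \<in> {\<one>}"
    unfolding a(3) using a(1) b by (simp add: m_assoc)
qed (simp_all add: triv_subgroup)

end

section \<open>Transport of commutator ideals along homomorphisms\<close>

locale mla_morphism = dom: mult_lie_algebra F + cod: mult_lie_algebra E
  for F :: "'f mla" and E :: "'e mla" +
  fixes h assumes mla_hom: "h \<in> mla_hom F E"

sublocale mla_morphism \<subseteq> group_hom F E h
  using mla_hom by unfold_locales (simp add: mla_hom_def)

context mla_morphism
begin

lemma hom_star:
  "x \<in> carrier F \<Longrightarrow> y \<in> carrier F \<Longrightarrow> h (x \<star>\<^bsub>F\<^esub> y) = h x \<star>\<^bsub>E\<^esub> h y"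
  using mla_hom by (simp add: mla_hom_def)

text \<open>The preimage of the target ideal is a subgroup containing all generators. A normal
  \<open>L\<close> stands in for the image of \<open>K\<close>, which need not be normal in
  \<open>E\<close>.\<close>

lemma commutator_image:
  assumes K: "K \<subseteq> carrier F" and L: "L \<lhd> E" and KL: "h ` K \<subseteq> L"
    and v: "v \<in> mla_commutator F K (carrier F)"
  shows "h v \<in> mla_commutator E L (carrier E)"
proof -
  let ?C = "mla_commutator E L (carrier E)"
  have C: "subgroup ?C E"
    by (rule normal_imp_subgroup[OF cod.normal_mla_commutator[OF L cod.normal_carrier]])
  have LE: "L \<subseteq> carrier E"
    using L by (auto dest: normal_imp_subgroup subgroup.subset)
  have "mla_commutator F K (carrier F) \<subseteq> {v \<in> carrier F. h v \<in> ?C}"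
  proof (rule dom.mla_commutator_least[OF K subset_refl])
    show "subgroup {v \<in> carrier F. h v \<in> ?C} F"
      using C by (intro dom.subgroupI)
        (auto simp: subgroup.m_inv_closed subgroup.m_closed subgroup.one_closed
          intro!: exI[of _ "\<one>\<^bsub>F\<^esub>"])
  next
    fix a b assume "a \<in> K" and b: "b \<in> carrier F"
    then have a: "a \<in> carrier F" "h a \<in> L"
      using K KL by auto
    show "a \<star>\<^bsub>F\<^esub> b \<in> {v \<in> carrier F. h v \<in> ?C}"
      using a b cod.mla_commutator_star[OF LE subset_refl a(2), of "h b"] by (simp add: hom_star)
    show "a \<otimes>\<^bsub>F\<^esub> b \<otimes>\<^bsub>F\<^esub> inv\<^bsub>F\<^esub> a \<otimes>\<^bsub>F\<^esub> inv\<^bsub>F\<^esub> b \<in> {v \<in> carrier F. h v \<in> ?C}"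
      using a b cod.mla_commutator_comm[OF LE subset_refl a(2), of "h b"] by simp
  qed
  with v show ?thesis
    by blast
qed

text \<open>Modulo \<open>mla_commutator E K (carrier E)\<close> the elements of \<open>K\<close>
  are central with trivial star products. So a generator of the commutator ideal of \<open>E\<close>
  depends only on the \<open>h u\<close> parts of its two arguments and comes from a generator in
  \<open>F\<close>.\<close>

lemma commutator_factor:
  assumes K: "K \<lhd> E"
    and cover: "\<And>x. x \<in> carrier E \<Longrightarrow> \<exists>u\<in>carrier F. \<exists>k\<in>K. x = h u \<otimes>\<^bsub>E\<^esub> k"
    and x: "x \<in> mla_commutator E (carrier E) (carrier E)"
  shows "\<exists>v\<in>mla_commutator F (carrier F) (carrier F). \<exists>w\<in>mla_commutator E K (carrier E).
    x = w \<otimes>\<^bsub>E\<^esub> h v"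
proof -
  define D where "D = mla_commutator F (carrier F) (carrier F)"
  define C where "C = mla_commutator E K (carrier E)"
  have KE: "K \<subseteq> carrier E"
    using K by (auto dest: normal_imp_subgroup subgroup.subset)
  have C: "C \<lhd> E"
    unfolding C_def by (rule cod.normal_mla_commutator[OF K cod.normal_carrier])
  have D: "subgroup D F"
    unfolding D_def
    by (rule normal_imp_subgroup[OF dom.normal_mla_commutator[OF dom.normal_carrier dom.normal_carrier]])
  interpret C: normal C E by (rule C)
  interpret D: subgroup D F by (rule D)
  let ?Q = "E Mod C"
  define q where "q = (\<lambda>x. C #>\<^bsub>E\<^esub> x)"
  have Q: "group ?Q"
    by (rule C.factorgroup_is_group)
  have q: "q \<in> hom E ?Q"
    unfolding q_def by (rule C.r_coset_hom_Mod)
  interpret q: group_hom E ?Q q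
    using Q q by (simp add: group_hom_def group_hom_axioms_def)
  have q_one: "q c = \<one>\<^bsub>?Q\<^esub>" if "c \<in> C" for c
    unfolding q_def using that by (simp add: FactGroup_def C.rcos_const)
  \<comment> \<open>The elements congruent modulo \<open>C\<close> to an element of
    \<open>h(D)\<close>. They form a subgroup, so it is enough to find all generators in it.\<close>
  let ?S = "{z \<in> carrier E. \<exists>v\<in>D. q z = q (h v)}"
  have "mla_commutator E (carrier E) (carrier E) \<subseteq> ?S"
  proof (rule cod.mla_commutator_least[OF subset_refl subset_refl])
    show "subgroup ?S E"
    proof (rule cod.subgroupI)
      show "?S \<noteq> {}"
        using D.one_closed by (auto intro!: exI[of _ "\<one>\<^bsub>E\<^esub>"] bexI[of _ "\<one>\<^bsub>F\<^esub>"])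
      fix a assume "a \<in> ?S"
      then obtain v where v: "a \<in> carrier E" "v \<in> D" "q a = q (h v)" by blast
      then have "q (inv\<^bsub>E\<^esub> a) = q (h (inv\<^bsub>F\<^esub> v))" by simp
      with v show "inv\<^bsub>E\<^esub> a \<in> ?S" by blast
      fix b assume "b \<in> ?S"
      then obtain w where w: "b \<in> carrier E" "w \<in> D" "q b = q (h w)" by blast
      then have "q (a \<otimes>\<^bsub>E\<^esub> b) = q (h (v \<otimes>\<^bsub>F\<^esub> w))" using v by simp
      with v w show "a \<otimes>\<^bsub>E\<^esub> b \<in> ?S" by blast
    qed auto
  next
    fix a b assume ab: "a \<in> carrier E" "b \<in> carrier E"
    obtain u k where u: "u \<in> carrier F" "k \<in> K" "a = h u \<otimes>\<^bsub>E\<^esub> k"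
      using cover[OF ab(1)] by blast
    obtain v l where v: "v \<in> carrier F" "l \<in> K" "b = h v \<otimes>\<^bsub>E\<^esub> l"
      using cover[OF ab(2)] by blast
    have kl: "k \<in> carrier E" "l \<in> carrier E"
      using u v KE by auto
    have "q (a \<star>\<^bsub>E\<^esub> b) = q (h u \<star>\<^bsub>E\<^esub> h v)"
      unfolding u(3) v(3) using u v
      by (intro cod.star_hom_cong[OF Q q KE] q_one)
        (auto simp: C_def intro: cod.mla_commutator_star[OF KE])
    moreover have "u \<star>\<^bsub>F\<^esub> v \<in> D"
      unfolding D_def using u v by (intro dom.mla_commutator_star) auto
    ultimately show "a \<star>\<^bsub>E\<^esub> b \<in> ?S"
      using ab u v by (auto simp: hom_star[symmetric])
    \<comment> \<open>Commutators of \<open>K\<close> with \<open>E\<close> lie in \<open>C\<close>,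
      so \<open>K\<close> becomes central in the quotient group and
      \<open>commutator_hom_cong\<close> applies.\<close>
    have comm: "q m \<otimes>\<^bsub>?Q\<^esub> q z = q z \<otimes>\<^bsub>?Q\<^esub> q m" if "m \<in> K" "z \<in> carrier E" for m z
    proof (rule q.hom_commute)
      show "q (m \<otimes>\<^bsub>E\<^esub> z \<otimes>\<^bsub>E\<^esub> inv\<^bsub>E\<^esub> m \<otimes>\<^bsub>E\<^esub> inv\<^bsub>E\<^esub> z) = \<one>\<^bsub>?Q\<^esub>"
        using that by (intro q_one) (auto simp: C_def intro!: cod.mla_commutator_comm[OF KE])
    qed (use that KE in auto)
    have "q (a \<otimes>\<^bsub>E\<^esub> b \<otimes>\<^bsub>E\<^esub> inv\<^bsub>E\<^esub> a \<otimes>\<^bsub>E\<^esub> inv\<^bsub>E\<^esub> b)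
        = q (h u \<otimes>\<^bsub>E\<^esub> h v \<otimes>\<^bsub>E\<^esub> inv\<^bsub>E\<^esub> h u \<otimes>\<^bsub>E\<^esub> inv\<^bsub>E\<^esub> h v)"
      unfolding u(3) v(3)
      by (rule q.commutator_hom_cong[OF _ _ kl comm[OF u(2)] comm[OF v(2)]]) (simp_all add: u(1) v(1))
    also have "\<dots> = q (h (u \<otimes>\<^bsub>F\<^esub> v \<otimes>\<^bsub>F\<^esub> inv\<^bsub>F\<^esub> u \<otimes>\<^bsub>F\<^esub> inv\<^bsub>F\<^esub> v))"
      using u v by simp
    finally show "a \<otimes>\<^bsub>E\<^esub> b \<otimes>\<^bsub>E\<^esub> inv\<^bsub>E\<^esub> a \<otimes>\<^bsub>E\<^esub> inv\<^bsub>E\<^esub> b \<in> ?S"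
      using ab dom.mla_commutator_comm[OF subset_refl subset_refl u(1) v(1)] unfolding D_def by blast
  qed
  with x obtain v where v: "x \<in> carrier E" "v \<in> D" "q x = q (h v)"
    by blast
  then have "x \<in> C #>\<^bsub>E\<^esub> h v"
    using cod.rcos_self[OF v(1) C.subgroup_axioms] by (simp add: q_def)
  then show ?thesis
    using v unfolding C_def[symmetric] D_def[symmetric] r_coset_def by blast
qed

end

section \<open>Images and quotients\<close>

text \<open>\<open>H\<close> is not known to be a group in advance. \<open>hom_imp_img_group\<close>
  yields a group with replaced carrier and unit, and the hypotheses say that these replacements are
  the original fields of \<open>H\<close>.\<close>

lemma group_surjective_image:
  assumes "group G" "q \<in> hom G H" "q \<one>\<^bsub>G\<^esub> = \<one>\<^bsub>H\<^esub>" "q ` carrier G = carrier H"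
  shows "group H"
proof -
  have "H\<lparr>carrier := q ` carrier G, one := q \<one>\<^bsub>G\<^esub>\<rparr> = H"
    using assms(3,4) by simp
  then show ?thesis
    using group.hom_imp_img_group[OF assms(1,2)] by simp
qed

text \<open>The axioms are equations, so they pass to \<open>H\<close> once all elements have
  preimages. This provides the algebra structure on quotients and on extensions defined by
  coboundaries.\<close>

lemma mla_surjective_image:
  assumes G: "mult_lie_algebra G"
    and q: "q \<in> hom G H" "q \<one>\<^bsub>G\<^esub> = \<one>\<^bsub>H\<^esub>" and surj: "q ` carrier G = carrier H"
    and star: "\<And>x y. x \<in> carrier G \<Longrightarrow> y \<in> carrier G \<Longrightarrow> q (x \<star>\<^bsub>G\<^esub> y) = q x \<star>\<^bsub>H\<^esub> q y"
  shows "mult_lie_algebra H"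
proof -
  interpret G: mult_lie_algebra G by (rule G)
  have H: "group H"
    by (rule group_surjective_image[OF G.is_group q surj])
  interpret q: group_hom G H q
    using q H by (simp add: group_hom_def group_hom_axioms_def)
  have conj: "conj_by H (q x) (q y) = q (conj_by G x y)" if "x \<in> carrier G" "y \<in> carrier G" for x y
    using that by (simp add: conj_by_def)
  have ex: "\<exists>x'\<in>carrier G. x = q x'" if "x \<in> carrier H" for x
    using that surj by blast
  show ?thesis
  proof (intro mult_lie_algebra.intro H mult_lie_algebra_axioms.intro)
    fix x y assume "x \<in> carrier H" "y \<in> carrier H"
    then obtain x' y' where [simp]: "x' \<in> carrier G" "y' \<in> carrier G" "x = q x'" "y = q y'"
      using ex by metis
    show "x \<star>\<^bsub>H\<^esub> y \<in> carrier H"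
      using q.hom_closed[of "x' \<star>\<^bsub>G\<^esub> y'"] by (simp add: star)
    show "x \<star>\<^bsub>H\<^esub> x = \<one>\<^bsub>H\<^esub>"
      by (simp add: star[symmetric] G.star_self)
  next
    fix x y z assume "x \<in> carrier H" "y \<in> carrier H" "z \<in> carrier H"
    then obtain x' y' z' where [simp]: "x' \<in> carrier G" "y' \<in> carrier G" "z' \<in> carrier G"
      "x = q x'" "y = q y'" "z = q z'"
      using ex by metis
    note s = star[symmetric] conj q.hom_mult[symmetric]
    show "x \<star>\<^bsub>H\<^esub> (y \<otimes>\<^bsub>H\<^esub> z) = (x \<star>\<^bsub>H\<^esub> y) \<otimes>\<^bsub>H\<^esub> conj_by H y (x \<star>\<^bsub>H\<^esub> z)"
      using G.star_mult_right[of x' y' z'] by (simp add: s del: q.hom_mult)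
    show "(x \<otimes>\<^bsub>H\<^esub> y) \<star>\<^bsub>H\<^esub> z = conj_by H x (y \<star>\<^bsub>H\<^esub> z) \<otimes>\<^bsub>H\<^esub> (x \<star>\<^bsub>H\<^esub> z)"
      using G.star_mult_left[of x' y' z'] by (simp add: s del: q.hom_mult)
    show "((x \<star>\<^bsub>H\<^esub> y) \<star>\<^bsub>H\<^esub> conj_by H y z) \<otimes>\<^bsub>H\<^esub> ((y \<star>\<^bsub>H\<^esub> z) \<star>\<^bsub>H\<^esub> conj_by H z x)
        \<otimes>\<^bsub>H\<^esub> ((z \<star>\<^bsub>H\<^esub> x) \<star>\<^bsub>H\<^esub> conj_by H x y) = \<one>\<^bsub>H\<^esub>"
      using G.star_jacobi[of x' y' z'] by (simp add: s del: q.hom_mult)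
    show "conj_by H z (x \<star>\<^bsub>H\<^esub> y) = conj_by H z x \<star>\<^bsub>H\<^esub> conj_by H z y"
      using G.conj_star[of x' y' z'] by (simp add: s del: q.hom_mult)
  qed
qed

lemma quot_mla_conv_Mod:
  "carrier (quot_mla G N) = carrier (G Mod N)" "monoid.mult (quot_mla G N) = monoid.mult (G Mod N)"
  "one (quot_mla G N) = one (G Mod N)"
  by (simp_all add: quot_mla_def FactGroup_def)

context mult_lie_algebra
begin

text \<open>The defining union ranges over representatives \<open>x k\<close> and \<open>y l\<close>
  with \<open>k\<close>, \<open>l\<close> in \<open>N\<close>. By \<open>star_hom_cong\<close> for
  the projection onto the group \<open>G Mod N\<close>, all of them yield the same coset.\<close>

lemma quot_mla_star:
  assumes N: "mla_ideal N G" and x: "x \<in> carrier G" and y: "y \<in> carrier G"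
  shows "(N #> x) \<star>\<^bsub>quot_mla G N\<^esub> (N #> y) = N #> (x \<star> y)"
proof -
  have n: "N \<lhd> G" and star: "\<And>x y. x \<in> carrier G \<Longrightarrow> y \<in> N \<Longrightarrow> x \<star> y \<in> N"
    using N by (auto simp: mla_ideal_def)
  interpret N: normal N G by (rule n)
  have cong: "N #> (a \<star> b) = N #> (x \<star> y)" if "a \<in> N #> x" "b \<in> N #> y" for a b
  proof -
    have "a \<in> x <# N" "b \<in> y <# N"
      using that x y N.coset_eq by auto
    then obtain k l where kl: "k \<in> N" "l \<in> N" "a = x \<otimes> k" "b = y \<otimes> l"
      by (auto simp: l_coset_def)
    show ?thesis
      unfolding kl(3,4)
    proof (rule star_hom_cong[OF N.factorgroup_is_group N.r_coset_hom_Mod N.subset _ x y kl(1,2)])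
      fix k e assume "k \<in> N" "e \<in> carrier G"
      \<comment> \<open>The definition of an ideal puts the element of \<open>N\<close> on the right
        of the star; antisymmetry moves it to the left.\<close>
      moreover from this have "k \<star> e \<in> N"
        using star[of e k] star_swap_inv[of e k] N.subset by auto
      ultimately show "N #> (k \<star> e) = \<one>\<^bsub>G Mod N\<^esub>"
        using N.subset by (simp add: FactGroup_def N.rcos_const)
    qed
  qed
  have "x \<in> N #> x" "y \<in> N #> y"
    using x y by (simp_all add: rcos_self N.subgroup_axioms)
  moreover have "(\<Union>a\<in>N #> x. \<Union>b\<in>N #> y. N #> (a \<star> b)) = (\<Union>a\<in>N #> x. \<Union>b\<in>N #> y. N #> (x \<star> y))"
    by (intro SUP_cong HOL.refl cong)
  ultimately show ?thesis
    by (auto simp: quot_mla_def)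
qed

lemma mla_morphism_quot:
  assumes N: "mla_ideal N G"
  shows "mla_morphism G (quot_mla G N) (\<lambda>x. N #> x)"
proof -
  have n: "N \<lhd> G"
    using N by (simp add: mla_ideal_def)
  interpret N: normal N G by (rule n)
  have hom: "(\<lambda>x. N #> x) \<in> hom G (quot_mla G N)"
    using N.r_coset_hom_Mod by (simp add: hom_def quot_mla_conv_Mod)
  have "mult_lie_algebra (quot_mla G N)"
  proof (rule mla_surjective_image[OF mult_lie_algebra_axioms hom])
    show "(\<lambda>x. N #> x) ` carrier G = carrier (quot_mla G N)"
      by (auto simp: quot_mla_def RCOSETS_def)
    show "N #> \<one> = \<one>\<^bsub>quot_mla G N\<^esub>"
      by (simp add: quot_mla_def coset_mult_one[OF N.subset])
  qed (simp add: quot_mla_star[OF N])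
  then show ?thesis
    using hom by (simp add: mla_morphism_def mla_morphism_axioms_def mult_lie_algebra_axioms
        mla_hom_def quot_mla_star[OF N])
qed

lemma kernel_quot:
  assumes "mla_ideal N G"
  shows "kernel G (quot_mla G N) (\<lambda>x. N #> x) = N"
proof -
  interpret N: normal N G using assms by (simp add: mla_ideal_def)
  show ?thesis
    using coset_join1[OF _ _ N.subgroup_axioms] N.rcos_const N.subset
    by (auto simp: kernel_def quot_mla_def)
qed

end

section \<open>Algebras with trivial multiplier\<close>

text \<open>These three name the canonical presentation from which \<open>schur_multiplier\<close>
  is formed.\<close>

abbreviation free_cover where "free_cover G \<equiv> free_mla (carrier G)"

abbreviation free_proj where "free_proj G \<equiv> free_lift G (\<lambda>x. x)"

abbreviation relators where "relators G \<equiv> kernel (free_cover G) G (free_proj G)"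

context mult_lie_algebra
begin

lemma mla_commutator_mono:
  assumes "A \<subseteq> A'" "B \<subseteq> B'"
  shows "mla_commutator G A B \<subseteq> mla_commutator G A' B'"
  unfolding mla_commutator_def star_span_def commutator_span_def
  by (intro mono_set_mult mono_generate) (use assms in blast)+

lemma mla_morphism_free_proj: "mla_morphism (free_cover G) G (free_proj G)"
  using free_mla_universal(1)[of "\<lambda>x. x" "carrier G"]
  by (simp add: mla_morphism_def mla_morphism_axioms_def mult_lie_algebra_free_mla
      mult_lie_algebra_axioms)

lemma free_proj_surj:
  assumes "x \<in> carrier G"
  shows "\<exists>u\<in>carrier (free_cover G). free_proj G u = x"
  using free_mla_universal(2)[of "\<lambda>x. x" "carrier G" x] assms
  by (intro bexI[of _ "term_class (carrier G) (Gen x)"])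
    (simp_all add: free_mla_class_closed)

text \<open>Send each generator to a chosen preimage under \<open>p\<close> and extend by freeness.
  The composite with \<open>p\<close> agrees with \<open>free_proj G\<close> on generators, hence
  everywhere by uniqueness.\<close>

lemma free_proj_lift:
  assumes "mla_morphism E G p" and surj: "p ` carrier E = carrier G"
  obtains \<phi> where "mla_morphism (free_cover G) E \<phi>"
    and "\<And>u. u \<in> carrier (free_cover G) \<Longrightarrow> p (\<phi> u) = free_proj G u"
proof -
  interpret p: mla_morphism E G p by fact
  define r where "r = inv_into (carrier E) p"
  have r: "r \<in> carrier G \<rightarrow> carrier E" "\<And>x. x \<in> carrier G \<Longrightarrow> p (r x) = x"
    unfolding r_def using surj by (auto intro: inv_into_into f_inv_into_f)
  let ?\<phi> = "free_lift E r"
  have \<phi>: "mla_morphism (free_cover G) E ?\<phi>"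
    using p.dom.free_mla_universal(1)[OF r(1)]
    by (simp add: mla_morphism_def mla_morphism_axioms_def mult_lie_algebra_free_mla
        p.dom.mult_lie_algebra_axioms)
  interpret \<phi>: mla_morphism "free_cover G" E ?\<phi> by (rule \<phi>)
  have "(\<lambda>u. p (?\<phi> u)) \<in> mla_hom (free_cover G) G"
    by (simp add: mla_hom_def hom_def \<phi>.hom_star p.hom_star)
  from free_mla_universal(3)[OF _ this, of "\<lambda>x. x"]
  have "p (?\<phi> u) = free_proj G u" if "u \<in> carrier (free_cover G)" for u
    using that r(2) p.dom.free_mla_universal(2)[OF r(1)] by simp
  with \<phi> show ?thesis
    by (rule that)
qed

lemma trivial_normal: "{\<one>} \<lhd> G"
  by (simp add: normal_inv_iff triv_subgroup)

lemma commutator_trivial: "mla_commutator G {\<one>} (carrier G) \<subseteq> {\<one>}"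
  by (rule central_commutator_trivial)
    (auto simp: mla_center_def lie_center_def group_center_def)

lemma commutator_normal_subgroup: "mla_commutator G (carrier G) (carrier G) \<lhd> G"
  by (rule normal_mla_commutator[OF normal_carrier normal_carrier])

end

context mla_morphism
begin

lemma inv_mult_in_kernel:
  "a \<in> carrier F \<Longrightarrow> b \<in> carrier F \<Longrightarrow> h a = h b \<Longrightarrow> inv\<^bsub>F\<^esub> a \<otimes>\<^bsub>F\<^esub> b \<in> kernel F E h"
  by (simp add: kernel_def)

text \<open>For central \<open>K\<close> the factor \<open>w\<close> supplied by
  \<open>commutator_factor\<close> is trivial. The lemma is used below for the trivial subgroup and
  for a central ideal.\<close>

lemma central_factor_surj:
  assumes K: "K \<lhd> E" "K \<subseteq> mla_center E"
    and cover: "\<And>x. x \<in> carrier E \<Longrightarrow> \<exists>u\<in>carrier F. \<exists>k\<in>K. x = h u \<otimes>\<^bsub>E\<^esub> k"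
    and x: "x \<in> mla_commutator E (carrier E) (carrier E)"
  shows "\<exists>v\<in>mla_commutator F (carrier F) (carrier F). x = h v"
proof -
  obtain v w where vw: "v \<in> mla_commutator F (carrier F) (carrier F)"
    "w \<in> mla_commutator E K (carrier E)" "x = w \<otimes>\<^bsub>E\<^esub> h v"
    using commutator_factor[OF K(1) cover x] by blast
  have "v \<in> carrier F"
    using vw(1) normal_imp_subgroup[OF dom.commutator_normal_subgroup] by (blast dest: subgroup.subset)
  moreover have "w = \<one>\<^bsub>E\<^esub>"
    using vw(2) cod.central_commutator_trivial[OF K(2)] by blast
  ultimately show ?thesis
    using vw by (intro bexI[of _ v]) auto
qed

lemma commutator_kernel_trivial:
  assumes "w \<in> mla_commutator F (kernel F E h) (carrier F)"
  shows "h w = \<one>\<^bsub>E\<^esub>"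
proof -
  have "h w \<in> mla_commutator E {\<one>\<^bsub>E\<^esub>} (carrier E)"
    by (rule commutator_image[OF _ cod.trivial_normal _ assms]) (auto simp: kernel_def)
  then show ?thesis
    using cod.commutator_trivial by blast
qed

end

lemma trivial_quot_subset:
  assumes "trivial_group (quot_mla (sub_mla G D) N)" "group G" "subgroup N G" "D \<subseteq> carrier G"
  shows "D \<subseteq> N"
proof
  fix x assume x: "x \<in> D"
  interpret group G by fact
  have "N #>\<^bsub>G\<^esub> x \<in> rcosets\<^bsub>sub_mla G D\<^esub> N"
    using x by (auto simp: RCOSETS_def sub_mla_def r_coset_def)
  then have "N #>\<^bsub>G\<^esub> x = N"
    using assms(1) by (simp add: trivial_group_def quot_mla_def)
  then show "x \<in> N"
    using coset_join1 assms x by blast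
qed

text \<open>The name follows group theory, where superperfect groups are those whose first and
  second integral homology vanish.\<close>

locale superperfect_mla = mult_lie_algebra G for G :: "'a mla" (structure) +
  assumes perfect: "mla_perfect G" and trivial_multiplier: "trivial_group (schur_multiplier G)"
begin

sublocale \<pi>: mla_morphism "free_cover G" G "free_proj G"
  by (rule mla_morphism_free_proj)

lemma commutator_Int_relators:
  "mla_commutator (free_cover G) (carrier (free_cover G)) (carrier (free_cover G)) \<inter> relators G
    \<subseteq> mla_commutator (free_cover G) (relators G) (carrier (free_cover G))"
  (is "?D \<subseteq> ?C")
proof (rule trivial_quot_subset)
  show "trivial_group (quot_mla (sub_mla (free_cover G) ?D) ?C)"
    using trivial_multiplier
    by (simp add: schur_multiplier_def presentation_multiplier_def Let_def)
  show "subgroup ?C (free_cover G)"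
    by (rule normal_imp_subgroup[OF \<pi>.dom.normal_mla_commutator[OF
            \<pi>.normal_kernel \<pi>.dom.normal_carrier]])
qed (auto simp: \<pi>.dom.is_group kernel_def)

lemma commutator_Int_kernel:
  assumes "mla_morphism H G p" and surj: "p ` carrier H = carrier G"
  shows "mla_commutator H (carrier H) (carrier H) \<inter> kernel H G p
    \<subseteq> mla_commutator H (kernel H G p) (carrier H)"
proof
  interpret p: mla_morphism H G p by fact
  let ?F = "free_cover G" and ?K = "kernel H G p"
  obtain \<phi> where \<phi>: "mla_morphism ?F H \<phi>"
    and p\<phi>: "\<And>u. u \<in> carrier ?F \<Longrightarrow> p (\<phi> u) = free_proj G u"
    using free_proj_lift[OF assms] by blast
  interpret \<phi>: mla_morphism ?F H \<phi> by (rule \<phi>)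
  \<comment> \<open>Some \<open>\<phi> u\<close> has the same image under \<open>p\<close> as
    \<open>y\<close>, so the two differ by an element of the kernel.\<close>
  have cover: "\<exists>u\<in>carrier ?F. \<exists>k\<in>?K. y = \<phi> u \<otimes>\<^bsub>H\<^esub> k" if y: "y \<in> carrier H" for y
  proof -
    obtain u where u: "u \<in> carrier ?F" "free_proj G u = p y"
      using free_proj_surj y p.hom_closed by blast
    have "inv\<^bsub>H\<^esub> (\<phi> u) \<otimes>\<^bsub>H\<^esub> y \<in> ?K"
      using u y p\<phi> by (intro p.inv_mult_in_kernel) auto
    moreover have "y = \<phi> u \<otimes>\<^bsub>H\<^esub> (inv\<^bsub>H\<^esub> (\<phi> u) \<otimes>\<^bsub>H\<^esub> y)"
      using u y by (simp add: p.dom.inv_mult_cancel)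
    ultimately show ?thesis
      using u by blast
  qed
  have C: "subgroup (mla_commutator H ?K (carrier H)) H"
    by (rule normal_imp_subgroup[OF p.dom.normal_mla_commutator[OF p.normal_kernel
            p.dom.normal_carrier]])
  fix x assume x: "x \<in> mla_commutator H (carrier H) (carrier H) \<inter> ?K"
  obtain v w where v: "v \<in> mla_commutator ?F (carrier ?F) (carrier ?F)"
    and w: "w \<in> mla_commutator H ?K (carrier H)" and xwv: "x = w \<otimes>\<^bsub>H\<^esub> \<phi> v"
    using \<phi>.commutator_factor[OF p.normal_kernel cover, of x] x by blast
  have vF: "v \<in> carrier ?F"
    using v normal_imp_subgroup[OF \<pi>.dom.commutator_normal_subgroup] by (blast dest: subgroup.subset)
  have wH: "w \<in> carrier H"
    using w C by (blast dest: subgroup.subset)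
  \<comment> \<open>\<open>p\<close> kills \<open>w\<close>, which lies in the commutator ideal of
    its kernel; thus \<open>v\<close> inherits the image of \<open>x\<close>, which is
    trivial.\<close>
  have "free_proj G v = p x"
    using p.commutator_kernel_trivial[OF w] vF wH p\<phi> by (simp add: xwv)
  then have "v \<in> relators G"
    using x vF by (simp add: kernel_def)
  then have "v \<in> mla_commutator ?F (relators G) (carrier ?F)"
    using v commutator_Int_relators by blast
  then have "\<phi> v \<in> mla_commutator H ?K (carrier H)"
    by (rule \<phi>.commutator_image[rotated 3, OF _ _ p.normal_kernel])
      (auto simp: kernel_def p\<phi>)
  then show "x \<in> mla_commutator H ?K (carrier H)"
    using w C by (simp add: xwv subgroup.m_closed)
qed

section \<open>Splitting of central extensions\<close>

lemma central_extension_section: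
  assumes "central_extension N E p G"
  obtains s where "s \<in> mla_hom G E" "\<And>x. x \<in> carrier G \<Longrightarrow> p (s x) = x"
proof -
  have p: "mla_morphism E G p" and surj: "p ` carrier E = carrier G"
    and N: "kernel E G p = N" "N \<subseteq> mla_center E"
    using assms by (auto simp: central_extension_def mla_morphism_def mla_morphism_axioms_def)
  interpret p: mla_morphism E G p by (rule p)
  define D where "D = mla_commutator E (carrier E) (carrier E)"
  have D: "subgroup D E"
    unfolding D_def by (rule normal_imp_subgroup[OF p.dom.commutator_normal_subgroup])
  interpret D: subgroup D E by (rule D)
  \<comment> \<open>Elements of \<open>D\<close> with equal images differ by an element of
    \<open>D\<close> in the kernel. \<open>commutator_Int_kernel\<close> puts it into the commutator
    ideal of a central subgroup, which is trivial.\<close>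
  have inj: "a = b" if "a \<in> D" "b \<in> D" "p a = p b" for a b
  proof -
    have "inv\<^bsub>E\<^esub> a \<otimes>\<^bsub>E\<^esub> b \<in> D \<inter> kernel E G p"
      using that by (auto intro!: p.inv_mult_in_kernel)
    then have "inv\<^bsub>E\<^esub> a \<otimes>\<^bsub>E\<^esub> b = \<one>\<^bsub>E\<^esub>"
      using commutator_Int_kernel[OF p surj] p.dom.central_commutator_trivial[OF N(2)]
      unfolding D_def N(1) by blast
    then show ?thesis
      using that p.dom.inv_solve_left[of b a "\<one>\<^bsub>E\<^esub>"] by (metis D.mem_carrier p.dom.inv_mult_cancel(2) p.dom.r_one)
  qed
  \<comment> \<open>With the trivial subgroup as \<open>K\<close>, the covering hypothesis of
    \<open>central_factor_surj\<close> is surjectivity of \<open>p\<close>. Perfectness places every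
    \<open>x\<close> in the commutator ideal of \<open>G\<close>.\<close>
  have onto: "\<exists>a\<in>D. x = p a" if "x \<in> carrier G" for x
    unfolding D_def
  proof (rule p.central_factor_surj)
    show "x \<in> mla_commutator G (carrier G) (carrier G)"
      using that perfect by (simp add: mla_perfect_def)
    fix y assume "y \<in> carrier G"
    then obtain u where "u \<in> carrier E" "y = p u"
      using surj by blast
    then show "\<exists>u\<in>carrier E. \<exists>k\<in>{\<one>}. y = p u \<otimes> k"
      by (intro bexI[of _ u] bexI[of _ "\<one>"]) auto
  qed (auto simp: trivial_normal mla_center_def lie_center_def group_center_def)
  define s where "s = inv_into D p"
  have s: "s x \<in> D" "p (s x) = x" if "x \<in> carrier G" for x
  proof -
    have "x \<in> p ` D" using onto[OF that] by blast
    then show "s x \<in> D" "p (s x) = x"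
      unfolding s_def by (rule inv_into_into, rule f_inv_into_f)
  qed
  have sE: "s x \<in> carrier E" if "x \<in> carrier G" for x
    using s(1)[OF that] by simp
  have "s \<in> mla_hom G E"
    unfolding mla_hom_def hom_def
  proof (intro CollectI conjI ballI Pi_I)
    fix x y assume xy: "x \<in> carrier G" "y \<in> carrier G"
    \<comment> \<open>Both sides lie in \<open>D\<close> and have the same image under
      \<open>p\<close>, so injectivity on \<open>D\<close> identifies them; the star product is
      treated alike.\<close>
    show "s (x \<otimes> y) = s x \<otimes>\<^bsub>E\<^esub> s y"
      using xy by (intro inj) (simp_all add: s sE)
    show "s (x \<star> y) = s x \<star>\<^bsub>E\<^esub> s y"
    proof (rule inj)
      show "s x \<star>\<^bsub>E\<^esub> s y \<in> D"
        unfolding D_def using xy sE by (intro p.dom.mla_commutator_star) auto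
    qed (use xy in \<open>simp_all add: s sE p.hom_star\<close>)
  qed (rule sE)
  then show ?thesis
    using s(2) that by blast
qed

section \<open>The multiplier of a central quotient\<close>

lemma central_quotient_multiplier:
  assumes N: "central_ideal N G"
  shows "sub_mla G N \<cong>\<^sub>M schur_multiplier (quot_mla G N)"
proof -
  have id: "mla_ideal N G" and cent: "N \<subseteq> mla_center G"
    using N by (auto simp: central_ideal_def)
  then have NG: "N \<lhd> G"
    by (simp add: mla_ideal_def)
  interpret N: normal N G by (rule NG)
  define Q where "Q = quot_mla G N"
  define p where "p = (\<lambda>x. N #> x)"
  have p: "mla_morphism G Q p"
    unfolding Q_def p_def by (rule mla_morphism_quot[OF id])
  have p_surj: "p ` carrier G = carrier Q"
    by (auto simp: Q_def p_def quot_mla_def RCOSETS_def)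
  have ker_p: "kernel G Q p = N"
    unfolding Q_def p_def by (rule kernel_quot[OF id])
  interpret p: mla_morphism G Q p by (rule p)
  let ?F = "free_cover Q" and ?R = "relators Q"
  interpret \<rho>: mla_morphism ?F Q "free_proj Q"
    by (rule p.cod.mla_morphism_free_proj)
  obtain \<psi> where \<psi>: "mla_morphism ?F G \<psi>"
    and p\<psi>: "\<And>u. u \<in> carrier ?F \<Longrightarrow> p (\<psi> u) = free_proj Q u"
    using p.cod.free_proj_lift[OF p p_surj] by blast
  interpret \<psi>: mla_morphism ?F G \<psi> by (rule \<psi>)
  define D where "D = mla_commutator ?F (carrier ?F) (carrier ?F)"
  define C where "C = mla_commutator ?F ?R (carrier ?F)"
  have R: "?R \<lhd> ?F"
    by (rule \<rho>.normal_kernel)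
  have RF: "?R \<subseteq> carrier ?F"
    by (auto simp: kernel_def)
  have Cn: "C \<lhd> ?F"
    unfolding C_def by (rule \<rho>.dom.normal_mla_commutator[OF R \<rho>.dom.normal_carrier])
  interpret C: normal C ?F by (rule Cn)
  have Ds: "subgroup D ?F"
    unfolding D_def by (rule normal_imp_subgroup[OF \<rho>.dom.commutator_normal_subgroup])
  interpret D: subgroup D ?F by (rule Ds)
  have \<psi>R: "\<psi> u \<in> N \<longleftrightarrow> u \<in> ?R" if "u \<in> carrier ?F" for u
  proof -
    have "\<psi> u \<in> kernel G Q p \<longleftrightarrow> u \<in> ?R"
      using that p\<psi>[OF that] by (simp add: kernel_def)
    then show ?thesis
      by (simp only: ker_p)
  qed
  \<comment> \<open>The image of \<open>\<psi>\<close> meets every coset of \<open>N\<close>, and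
    passing to commutators removes the central factor from \<open>N\<close>. As \<open>G\<close> is
    perfect, already \<open>D\<close> maps onto it.\<close>
  have \<psi>_onto: "\<exists>v\<in>D. x = \<psi> v" if x: "x \<in> carrier G" for x
    unfolding D_def
  proof (rule \<psi>.central_factor_surj[OF NG cent])
    show "x \<in> mla_commutator G (carrier G) (carrier G)"
      using x perfect by (simp add: mla_perfect_def)
    fix y assume y: "y \<in> carrier G"
    obtain u where u: "u \<in> carrier ?F" "free_proj Q u = p y"
      using p.cod.free_proj_surj y p.hom_closed by blast
    have "inv (\<psi> u) \<otimes> y \<in> N"
      using u y p\<psi> p.inv_mult_in_kernel[of "\<psi> u" y] by (simp add: ker_p)
    moreover have "y = \<psi> u \<otimes> (inv (\<psi> u) \<otimes> y)"
      using u y by (simp add: inv_mult_cancel)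
    ultimately show "\<exists>u\<in>carrier ?F. \<exists>k\<in>N. y = \<psi> u \<otimes> k"
      using u by blast
  qed
  have \<psi>_surj: "\<psi> ` carrier ?F = carrier G"
    using \<psi>_onto by (auto; blast dest: D.mem_carrier)
  have ker_\<psi>: "kernel ?F G \<psi> \<subseteq> ?R"
  proof
    fix u assume "u \<in> kernel ?F G \<psi>"
    then have "u \<in> carrier ?F" "\<psi> u \<in> N"
      by (simp_all add: kernel_def N.one_closed)
    then show "u \<in> ?R"
      by (simp only: \<psi>R)
  qed
  have CD: "C \<subseteq> D"
    unfolding C_def D_def by (rule \<rho>.dom.mla_commutator_mono[OF RF subset_refl])
  have \<psi>C: "\<psi> c = \<one>" if "c \<in> C" for c
  proof -
    have "\<psi> c \<in> mla_commutator G N (carrier G)"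
      using that unfolding C_def
      by (rule \<psi>.commutator_image[rotated 3, OF _ RF NG]) (use \<psi>R RF in auto)
    then show ?thesis
      using central_commutator_trivial[OF cent] by blast
  qed
  \<comment> \<open>\<open>commutator_Int_kernel\<close> for \<open>\<psi>\<close> puts
    \<open>u\<close> into the commutator ideal of the kernel of \<open>\<psi>\<close>. That kernel
    consists of relators of \<open>Q\<close>, so the ideal lies in \<open>C\<close>.\<close>
  have D_ker: "u \<in> C" if "u \<in> D" "\<psi> u = \<one>" for u
    using commutator_Int_kernel[OF \<psi> \<psi>_surj] that
      \<rho>.dom.mla_commutator_mono[OF ker_\<psi> subset_refl] D.mem_carrier
    unfolding D_def C_def by (fastforce simp: kernel_def)
  \<comment> \<open>The fibre of \<open>\<psi>\<close> over \<open>n\<close> inside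
    \<open>D\<close>. By \<open>D_ker\<close> and \<open>\<psi>C\<close> it is a full coset of
    \<open>C\<close>, so the inverse of the induced isomorphism is obtained without choosing
    representatives.\<close>
  define \<theta> where "\<theta> = (\<lambda>n. {u \<in> D. \<psi> u = n})"
  have \<theta>: "\<theta> (\<psi> u) = C #>\<^bsub>?F\<^esub> u" if u: "u \<in> D" for u
  proof (intro equalityI subsetI)
    fix v assume "v \<in> \<theta> (\<psi> u)"
    then have v: "v \<in> D" "\<psi> v = \<psi> u"
      by (auto simp: \<theta>_def)
    then have "v \<otimes>\<^bsub>?F\<^esub> inv\<^bsub>?F\<^esub> u \<in> C"
      using u by (intro D_ker) simp_all
    moreover have "v = v \<otimes>\<^bsub>?F\<^esub> inv\<^bsub>?F\<^esub> u \<otimes>\<^bsub>?F\<^esub> u"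
      using u v by (simp add: \<rho>.dom.m_assoc)
    ultimately show "v \<in> C #>\<^bsub>?F\<^esub> u"
      unfolding r_coset_def by blast
  next
    fix v assume "v \<in> C #>\<^bsub>?F\<^esub> u"
    then obtain c where c: "c \<in> C" "v = c \<otimes>\<^bsub>?F\<^esub> u"
      by (auto simp: r_coset_def)
    then show "v \<in> \<theta> (\<psi> u)"
      using u CD \<psi>C[OF c(1)] by (auto simp: \<theta>_def)
  qed
  let ?S = "schur_multiplier Q"
  have S: "carrier ?S = (\<lambda>u. C #>\<^bsub>?F\<^esub> u) ` (D \<inter> ?R)"
    "\<And>S T. S \<otimes>\<^bsub>?S\<^esub> T = S <#>\<^bsub>?F\<^esub> T"
    "\<And>S T. S \<star>\<^bsub>?S\<^esub> T = (\<Union>a\<in>S. \<Union>b\<in>T. C #>\<^bsub>?F\<^esub> (a \<star>\<^bsub>?F\<^esub> b))"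
    by (auto simp: schur_multiplier_def presentation_multiplier_def Let_def quot_mla_def
        sub_mla_def RCOSETS_def r_coset_def set_mult_def C_def D_def)
  have rep: "\<exists>u\<in>D \<inter> ?R. n = \<psi> u" if n: "n \<in> N" for n
  proof -
    obtain u where u: "u \<in> D" "n = \<psi> u"
      using \<psi>_onto[OF N.mem_carrier[OF n]] by blast
    then have "u \<in> ?R"
      using n \<psi>R[OF D.mem_carrier[OF u(1)]] by simp
    with u show ?thesis by blast
  qed
  have "\<theta> \<in> mla_hom (sub_mla G N) ?S"
    unfolding mla_hom_def hom_def
  proof (intro CollectI conjI ballI Pi_I)
    fix n assume "n \<in> carrier (sub_mla G N)"
    then obtain u where "u \<in> D \<inter> ?R" "n = \<psi> u"
      using rep by (auto simp: sub_mla_def)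
    then show "\<theta> n \<in> carrier ?S"
      using \<theta> by (auto simp: S)
  next
    fix n m assume "n \<in> carrier (sub_mla G N)" "m \<in> carrier (sub_mla G N)"
    then have nm: "n \<in> N" "m \<in> N"
      by (simp_all add: sub_mla_def)
    then obtain u v where u: "u \<in> D \<inter> ?R" "n = \<psi> u" and v: "v \<in> D \<inter> ?R" "m = \<psi> v"
      using rep by metis
    have "\<theta> (n \<otimes> m) = C #>\<^bsub>?F\<^esub> (u \<otimes>\<^bsub>?F\<^esub> v)"
      using u v \<theta>[of "u \<otimes>\<^bsub>?F\<^esub> v"] by simp
    also have "\<dots> = \<theta> n <#>\<^bsub>?F\<^esub> \<theta> m"
      using u v \<theta> by (simp add: C.rcos_sum)
    finally show "\<theta> (n \<otimes>\<^bsub>sub_mla G N\<^esub> m) = \<theta> n \<otimes>\<^bsub>?S\<^esub> \<theta> m"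
      by (simp add: S sub_mla_def)
    \<comment> \<open>Representatives over \<open>N\<close> are relators, so their star products
      fall into \<open>C\<close>. The star product of the multiplier is thus trivial here, matching
      that of the central ideal \<open>N\<close>.\<close>
    have "C #>\<^bsub>?F\<^esub> (a \<star>\<^bsub>?F\<^esub> b) = C" if "a \<in> \<theta> n" "b \<in> \<theta> m" for a b
    proof -
      have "a \<in> ?R" "b \<in> carrier ?F"
        using that nm \<psi>R by (auto simp: \<theta>_def)
      then have "a \<star>\<^bsub>?F\<^esub> b \<in> C"
        unfolding C_def by (intro \<rho>.dom.mla_commutator_star RF subset_refl)
      then show ?thesis
        by (rule C.rcos_const[OF \<rho>.dom.is_group])
    qed
    then have "\<theta> n \<star>\<^bsub>?S\<^esub> \<theta> m = (\<Union>a\<in>\<theta> n. \<Union>b\<in>\<theta> m. C)"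
      unfolding S by (intro SUP_cong HOL.refl)
    also have "\<dots> = C"
      using u v by (auto simp: \<theta>_def)
    also have "C = \<theta> \<one>"
      using \<theta>[OF D.one_closed] by (simp add: \<rho>.dom.coset_mult_one C.subset)
    also have "\<one> = n \<star> m"
    proof -
      have "n \<in> lie_center G" "m \<in> carrier G"
        using nm cent by (auto simp: mla_center_def)
      then show ?thesis
        by (simp add: lie_center_def)
    qed
    finally show "\<theta> (n \<star>\<^bsub>sub_mla G N\<^esub> m) = \<theta> n \<star>\<^bsub>?S\<^esub> \<theta> m"
      by (simp add: sub_mla_def)
  qed
  moreover have "bij_betw \<theta> (carrier (sub_mla G N)) (carrier ?S)"
    unfolding bij_betw_def
  proof
    \<comment> \<open>The fibres over points of \<open>N\<close> are nonempty, and fibres over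
      distinct points are disjoint.\<close>
    show "inj_on \<theta> (carrier (sub_mla G N))"
    proof (rule inj_onI)
      fix n m assume "n \<in> carrier (sub_mla G N)" "\<theta> n = \<theta> m"
      moreover from this obtain u where "u \<in> D \<inter> ?R" "n = \<psi> u"
        using rep[of n] by (auto simp: sub_mla_def)
      then have "u \<in> \<theta> n"
        by (simp add: \<theta>_def)
      ultimately have "u \<in> \<theta> n" "u \<in> \<theta> m"
        by simp_all
      then show "n = m"
        by (simp add: \<theta>_def)
    qed
    have "\<theta> ` N = (\<lambda>u. C #>\<^bsub>?F\<^esub> u) ` (D \<inter> ?R)"
    proof (intro equalityI subsetI)
      fix Y assume "Y \<in> \<theta> ` N"
      then obtain n where "n \<in> N" "Y = \<theta> n"
        by blast
      moreover obtain u where "u \<in> D \<inter> ?R" "n = \<psi> u"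
        using rep[OF \<open>n \<in> N\<close>] by blast
      ultimately show "Y \<in> (\<lambda>u. C #>\<^bsub>?F\<^esub> u) ` (D \<inter> ?R)"
        using \<theta>[of u] by simp
    next
      fix Y assume "Y \<in> (\<lambda>u. C #>\<^bsub>?F\<^esub> u) ` (D \<inter> ?R)"
      then obtain u where u: "u \<in> D" "u \<in> ?R" "Y = \<theta> (\<psi> u)"
        using \<theta> by auto
      moreover have "\<psi> u \<in> N"
        using \<psi>R[OF D.mem_carrier[OF u(1)]] u(2) by simp
      ultimately show "Y \<in> \<theta> ` N"
        by simp
    qed
    then show "\<theta> ` carrier (sub_mla G N) = carrier ?S"
      by (simp add: S sub_mla_def)
  qed
  ultimately show ?thesis
    unfolding mla_iso_def Q_def by blast
qed

lemma central_quotient_stem_cover: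
  assumes N: "central_ideal N G"
  shows "stem_cover N G (\<lambda>x. N #> x) (quot_mla G N)"
proof -
  have id: "mla_ideal N G" and cent: "N \<subseteq> mla_center G"
    using N by (auto simp: central_ideal_def)
  interpret p: mla_morphism G "quot_mla G N" "\<lambda>x. N #> x"
    by (rule mla_morphism_quot[OF id])
  have "(\<lambda>x. N #> x) ` carrier G = carrier (quot_mla G N)"
    by (auto simp: quot_mla_def RCOSETS_def)
  \<comment> \<open>The stem condition is automatic: in a perfect algebra the commutator ideal is
    everything.\<close>
  moreover have "N \<subseteq> mla_commutator G (carrier G) (carrier G)"
    using cent perfect by (auto simp: mla_perfect_def mla_center_def lie_center_def)
  ultimately show ?thesis
    using cent central_quotient_multiplier[OF N] kernel_quot[OF id] p.mla_hom
      mult_lie_algebra_axioms p.cod.mult_lie_algebra_axioms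
    by (simp add: stem_cover_def stem_extension_def central_extension_def)
qed

end
section \<open>Cocycles and coboundaries\<close>

lemma ext_mla_simps [simp]:
  "carrier (ext_mla G A f h) = carrier A \<times> carrier G"
  "\<one>\<^bsub>ext_mla G A f h\<^esub> = (\<one>\<^bsub>A\<^esub>, \<one>\<^bsub>G\<^esub>)"
  "(a, x) \<otimes>\<^bsub>ext_mla G A f h\<^esub> (b, y) = (a \<otimes>\<^bsub>A\<^esub> b \<otimes>\<^bsub>A\<^esub> f (x, y), x \<otimes>\<^bsub>G\<^esub> y)"
  "(a, x) \<star>\<^bsub>ext_mla G A f h\<^esub> (b, y) = (h (x, y), x \<star>\<^bsub>G\<^esub> y)"
  by (simp_all add: ext_mla_def)

context mult_lie_algebra
begin

lemma ext_mla_central_extension: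
  assumes A: "comm_group A" and fh: "(f, h) \<in> ml_cocycles G A"
  shows "central_extension (carrier A \<times> {\<one>}) (ext_mla G A f h) snd G"
proof -
  interpret A: comm_group A by (rule A)
  let ?E = "ext_mla G A f h"
  have E: "mult_lie_algebra ?E"
    and f1: "\<And>x. x \<in> carrier G \<Longrightarrow> f (x, \<one>) = \<one>\<^bsub>A\<^esub> \<and> f (\<one>, x) = \<one>\<^bsub>A\<^esub>"
    using fh by (auto simp: ml_cocycles_def)
  interpret E: mult_lie_algebra ?E by (rule E)
  \<comment> \<open>Normalisation is imposed on \<open>f\<close> only. For \<open>h\<close> it
    follows from the triviality of star products with the unit in the extension.\<close>
  have h1: "h (\<one>, y) = \<one>\<^bsub>A\<^esub>" if "y \<in> carrier G" for y
    using E.one_star[of "(\<one>\<^bsub>A\<^esub>, y)"] that by simp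
  have "carrier A \<times> {\<one>} \<subseteq> mla_center ?E"
    by (auto simp: mla_center_def lie_center_def group_center_def f1 h1 A.m_comm)
  moreover have "snd ` (carrier A \<times> carrier G) = carrier G"
    using A.one_closed by force
  moreover have "snd \<in> mla_hom ?E G"
    by (auto simp: mla_hom_def hom_def)
  ultimately show ?thesis
    using E mult_lie_algebra_axioms by (auto simp: central_extension_def kernel_def)
qed

text \<open>This is the direct product of \<open>A\<close> and \<open>G\<close>. Conjugation fixes
  the first coordinate because \<open>A\<close> is abelian, so every axiom reduces to the one in
  \<open>G\<close>.\<close>

lemma ext_mla_trivial_cocycle:
  assumes A: "comm_group A"
  shows "mult_lie_algebra (ext_mla G A (\<lambda>_. \<one>\<^bsub>A\<^esub>) (\<lambda>_. \<one>\<^bsub>A\<^esub>))"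
proof -
  interpret A: comm_group A by (rule A)
  let ?P = "ext_mla G A (\<lambda>_. \<one>\<^bsub>A\<^esub>) (\<lambda>_. \<one>\<^bsub>A\<^esub>)"
  have P: "group ?P"
  proof (rule groupI)
    fix x assume "x \<in> carrier ?P"
    then show "\<exists>y\<in>carrier ?P. y \<otimes>\<^bsub>?P\<^esub> x = \<one>\<^bsub>?P\<^esub>"
      by (intro bexI[of _ "(inv\<^bsub>A\<^esub> fst x, inv snd x)"]) auto
  qed (auto simp: m_assoc A.m_assoc)
  interpret P: group ?P by (rule P)
  have inv: "inv\<^bsub>?P\<^esub> (a, x) = (inv\<^bsub>A\<^esub> a, inv x)" if "a \<in> carrier A" "x \<in> carrier G" for a x
    using that by (intro P.inv_equality) auto
  have conj: "conj_by ?P (a, x) (b, y) = (b, conj_by G x y)"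
    if "a \<in> carrier A" "x \<in> carrier G" "b \<in> carrier A" "y \<in> carrier G" for a x b y
    using that A.m_comm[of a b] by (simp add: conj_by_def inv A.m_assoc)
  show ?thesis
    by (intro mult_lie_algebra.intro P mult_lie_algebra_axioms.intro)
      (auto simp: conj star_self star_mult_right star_mult_left star_jacobi conj_star)
qed

text \<open>The extension is a relabelled direct product: the map \<open>T\<close> sending
  \<open>(a, x)\<close> to \<open>a\<close> times the inverse of \<open>g x\<close>, paired with
  \<open>x\<close>, is onto and respects both operations, so \<open>mla_surjective_image\<close>
  applies.\<close>

lemma ml_coboundary_cocycle:
  assumes A: "comm_group A" and g: "g \<in> carrier G \<rightarrow> carrier A" "g \<one> = \<one>\<^bsub>A\<^esub>"
  shows "ml_coboundary G A g \<in> ml_cocycles G A"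
proof -
  interpret A: comm_group A by (rule A)
  obtain f h where fh: "ml_coboundary G A g = (f, h)"
    by (cases "ml_coboundary G A g")
  have gA [simp]: "x \<in> carrier G \<Longrightarrow> g x \<in> carrier A" for x
    using g by blast
  have fe: "f (x, y) = g x \<otimes>\<^bsub>A\<^esub> g y \<otimes>\<^bsub>A\<^esub> inv\<^bsub>A\<^esub> g (x \<otimes> y)"
    and he: "h (x, y) = inv\<^bsub>A\<^esub> g (x \<star> y)" if "x \<in> carrier G" "y \<in> carrier G" for x y
    using fh that by (auto simp: ml_coboundary_def)
  let ?P = "ext_mla G A (\<lambda>_. \<one>\<^bsub>A\<^esub>) (\<lambda>_. \<one>\<^bsub>A\<^esub>)"
  define T where "T = (\<lambda>(a, x). (a \<otimes>\<^bsub>A\<^esub> inv\<^bsub>A\<^esub> g x, x))"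
  have "mult_lie_algebra (ext_mla G A f h)"
  proof (rule mla_surjective_image[OF ext_mla_trivial_cocycle[OF A]])
    have "a \<otimes>\<^bsub>A\<^esub> b \<otimes>\<^bsub>A\<^esub> inv\<^bsub>A\<^esub> g (x \<otimes> y)
        = a \<otimes>\<^bsub>A\<^esub> inv\<^bsub>A\<^esub> g x \<otimes>\<^bsub>A\<^esub> (b \<otimes>\<^bsub>A\<^esub> inv\<^bsub>A\<^esub> g y) \<otimes>\<^bsub>A\<^esub> f (x, y)"
      if "a \<in> carrier A" "b \<in> carrier A" "x \<in> carrier G" "y \<in> carrier G" for a b x y
    proof -
      \<comment> \<open>Independent letters let commutativity regroup the factors before any
        cancellation; afterwards \<open>u'\<close> and \<open>v'\<close> become the inverses of
        \<open>u\<close> and \<open>v\<close>.\<close>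
      have "a \<otimes>\<^bsub>A\<^esub> u \<otimes>\<^bsub>A\<^esub> (b \<otimes>\<^bsub>A\<^esub> v) \<otimes>\<^bsub>A\<^esub> (u' \<otimes>\<^bsub>A\<^esub> v' \<otimes>\<^bsub>A\<^esub> w)
          = a \<otimes>\<^bsub>A\<^esub> b \<otimes>\<^bsub>A\<^esub> (u \<otimes>\<^bsub>A\<^esub> u') \<otimes>\<^bsub>A\<^esub> (v \<otimes>\<^bsub>A\<^esub> v') \<otimes>\<^bsub>A\<^esub> w"
        if "u \<in> carrier A" "v \<in> carrier A" "u' \<in> carrier A" "v' \<in> carrier A" "w \<in> carrier A"
        for u v u' v' w
        using that \<open>a \<in> carrier A\<close> \<open>b \<in> carrier A\<close> by (simp add: A.m_ac)
      from this[of "inv\<^bsub>A\<^esub> g x" "inv\<^bsub>A\<^esub> g y" "g x" "g y" "inv\<^bsub>A\<^esub> g (x \<otimes> y)"] show ?thesis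
        using that by (simp add: fe)
    qed
    then show "T \<in> hom ?P (ext_mla G A f h)"
      by (auto simp: hom_def T_def)
    show "T \<one>\<^bsub>?P\<^esub> = \<one>\<^bsub>ext_mla G A f h\<^esub>"
      by (simp add: T_def g)
    show "T ` carrier ?P = carrier (ext_mla G A f h)"
    proof (intro equalityI subsetI)
      fix z assume "z \<in> carrier (ext_mla G A f h)"
      then obtain a x where z: "z = (a, x)" "a \<in> carrier A" "x \<in> carrier G"
        by auto
      then have "z = T (a \<otimes>\<^bsub>A\<^esub> g x, x)"
        by (simp add: T_def A.m_assoc)
      then show "z \<in> T ` carrier ?P"
        using z by simp
    qed (auto simp: T_def)
    show "T (u \<star>\<^bsub>?P\<^esub> v) = T u \<star>\<^bsub>ext_mla G A f h\<^esub> T v" if "u \<in> carrier ?P" "v \<in> carrier ?P" for u v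
      using that by (auto simp: T_def he)
  qed
  moreover have "f \<in> carrier G \<times> carrier G \<rightarrow>\<^sub>E carrier A" "h \<in> carrier G \<times> carrier G \<rightarrow>\<^sub>E carrier A"
  proof -
    have "fst (ml_coboundary G A g) \<in> carrier G \<times> carrier G \<rightarrow>\<^sub>E carrier A"
      and "snd (ml_coboundary G A g) \<in> carrier G \<times> carrier G \<rightarrow>\<^sub>E carrier A"
      by (auto simp: ml_coboundary_def)
    then show "f \<in> carrier G \<times> carrier G \<rightarrow>\<^sub>E carrier A" "h \<in> carrier G \<times> carrier G \<rightarrow>\<^sub>E carrier A"
      by (simp_all add: fh)
  qed
  moreover have "f (x, \<one>) = \<one>\<^bsub>A\<^esub>" "f (\<one>, x) = \<one>\<^bsub>A\<^esub>" if "x \<in> carrier G" for x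
    using that by (simp_all add: fe g)
  ultimately show ?thesis
    unfolding fh by (simp add: ml_cocycles_def)
qed

lemma ml_coboundary_mult:
  assumes A: "comm_group A" and g: "g \<in> carrier G \<rightarrow> carrier A" "g' \<in> carrier G \<rightarrow> carrier A"
  shows "ml_coboundary G A g \<otimes>\<^bsub>ml_Z2 G A\<^esub> ml_coboundary G A g'
    = ml_coboundary G A (\<lambda>x. g x \<otimes>\<^bsub>A\<^esub> g' x)"
proof -
  interpret A: comm_group A by (rule A)
  have [simp]: "x \<in> carrier G \<Longrightarrow> g x \<in> carrier A" "x \<in> carrier G \<Longrightarrow> g' x \<in> carrier A" for x
    using g by blast+
  show ?thesis
    by (auto simp: ml_Z2_def ml_coboundary_def fun_eq_iff A.inv_mult_group A.m_ac restrict_def)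
qed

text \<open>Since every cocycle is assumed to be a coboundary, multiplicativity of
  \<open>?\<delta>\<close> carries the group laws over from pointwise products of cochains. Products
  of arbitrary cocycles are never examined.\<close>

lemma ml_Z2_group:
  assumes A: "comm_group A" and Z2: "ml_cocycles G A = ml_B2 G A"
  shows "group (ml_Z2 G A)"
proof -
  interpret A: comm_group A by (rule A)
  let ?\<Phi> = "{g. g \<in> carrier G \<rightarrow> carrier A \<and> g \<one> = \<one>\<^bsub>A\<^esub>}"
  let ?\<Z> = "ml_Z2 G A" and ?\<delta> = "ml_coboundary G A"
  have car: "carrier ?\<Z> = ?\<delta> ` ?\<Phi>"
    by (simp add: ml_Z2_def Z2 ml_B2_def)
  have one: "\<one>\<^bsub>?\<Z>\<^esub> = ?\<delta> (\<lambda>_. \<one>\<^bsub>A\<^esub>)"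
    by (auto simp: ml_Z2_def ml_coboundary_def fun_eq_iff restrict_def)
  have mult: "?\<delta> g \<otimes>\<^bsub>?\<Z>\<^esub> ?\<delta> g' = ?\<delta> (\<lambda>x. g x \<otimes>\<^bsub>A\<^esub> g' x)" if "g \<in> ?\<Phi>" "g' \<in> ?\<Phi>" for g g'
    using that by (intro ml_coboundary_mult[OF A]) auto
  \<comment> \<open>Cochains in \<open>?\<Phi>\<close> are not extensional, so the laws of
    \<open>A\<close> hold for them only on the carrier of \<open>G\<close>; that is all a coboundary
    sees.\<close>
  have cong: "?\<delta> g = ?\<delta> g'" if "\<And>x. x \<in> carrier G \<Longrightarrow> g x = g' x" for g g'
    using that by (auto simp: ml_coboundary_def fun_eq_iff restrict_def)
  show ?thesis
  proof (rule groupI; unfold car one)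
    show "?\<delta> (\<lambda>_. \<one>\<^bsub>A\<^esub>) \<in> ?\<delta> ` ?\<Phi>"
      by simp
  next
    fix u v assume "u \<in> ?\<delta> ` ?\<Phi>" "v \<in> ?\<delta> ` ?\<Phi>"
    then obtain g g' where g: "g \<in> ?\<Phi>" "g' \<in> ?\<Phi>" "u = ?\<delta> g" "v = ?\<delta> g'"
      by blast
    then have "(\<lambda>x. g x \<otimes>\<^bsub>A\<^esub> g' x) \<in> ?\<Phi>"
      by auto
    then show "u \<otimes>\<^bsub>?\<Z>\<^esub> v \<in> ?\<delta> ` ?\<Phi>"
      unfolding g(3,4) mult[OF g(1,2)] by (rule imageI)
  next
    fix u v w assume "u \<in> ?\<delta> ` ?\<Phi>" "v \<in> ?\<delta> ` ?\<Phi>" "w \<in> ?\<delta> ` ?\<Phi>"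
    then obtain g g' g'' where g: "g \<in> ?\<Phi>" "g' \<in> ?\<Phi>" "g'' \<in> ?\<Phi>"
      "u = ?\<delta> g" "v = ?\<delta> g'" "w = ?\<delta> g''"
      by blast
    have gg: "(\<lambda>x. g x \<otimes>\<^bsub>A\<^esub> g' x) \<in> ?\<Phi>" "(\<lambda>x. g' x \<otimes>\<^bsub>A\<^esub> g'' x) \<in> ?\<Phi>"
      using g(1-3) by auto
    show "u \<otimes>\<^bsub>?\<Z>\<^esub> v \<otimes>\<^bsub>?\<Z>\<^esub> w = u \<otimes>\<^bsub>?\<Z>\<^esub> (v \<otimes>\<^bsub>?\<Z>\<^esub> w)"
      unfolding g(4-6) mult[OF g(1,2)] mult[OF gg(1) g(3)] mult[OF g(2,3)] mult[OF g(1) gg(2)]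
      using g(1-3) by (intro cong A.m_assoc) auto
  next
    fix u assume "u \<in> ?\<delta> ` ?\<Phi>"
    then obtain g where g: "g \<in> ?\<Phi>" "u = ?\<delta> g"
      by blast
    then have gi: "(\<lambda>x. inv\<^bsub>A\<^esub> g x) \<in> ?\<Phi>" "(\<lambda>_. \<one>\<^bsub>A\<^esub>) \<in> ?\<Phi>"
      by auto
    have gA: "g x \<in> carrier A" if "x \<in> carrier G" for x
      using g(1) that by blast
    note m = mult[OF gi(1) g(1)] mult[OF gi(2) g(1)]
    show "?\<delta> (\<lambda>_. \<one>\<^bsub>A\<^esub>) \<otimes>\<^bsub>?\<Z>\<^esub> u = u"
      unfolding g(2) m using gA by (intro cong) simp
    have "?\<delta> (\<lambda>x. inv\<^bsub>A\<^esub> g x) \<otimes>\<^bsub>?\<Z>\<^esub> u = ?\<delta> (\<lambda>_. \<one>\<^bsub>A\<^esub>)"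
      unfolding g(2) m using gA by (intro cong) simp
    then show "\<exists>v\<in>?\<delta> ` ?\<Phi>. v \<otimes>\<^bsub>?\<Z>\<^esub> u = ?\<delta> (\<lambda>_. \<one>\<^bsub>A\<^esub>)"
      using gi(1) by blast
  qed
qed

end

lemma (in group) trivial_group_Mod_carrier: "trivial_group (G Mod carrier G)"
proof -
  have "rcosets carrier G = {carrier G}"
    using coset_join2[OF _ subgroup_self] by (auto simp: RCOSETS_def)
  then show ?thesis
    using normal.factorgroup_is_group[OF normal_carrier]
    by (simp add: trivial_group_def FactGroup_def)
qed

section \<open>Vanishing of the second cohomology\<close>

context superperfect_mla
begin

lemma cocycle_coboundary:
  assumes A: "comm_group A" and fh: "(f, h) \<in> ml_cocycles G A"
  shows "(f, h) \<in> ml_B2 G A"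
proof -
  interpret A: comm_group A by (rule A)
  let ?E = "ext_mla G A f h"
  obtain s where s: "s \<in> mla_hom G ?E" and sec: "\<And>x. x \<in> carrier G \<Longrightarrow> snd (s x) = x"
    using central_extension_section[OF ext_mla_central_extension[OF A fh]] by blast
  have E: "mult_lie_algebra ?E"
    and f: "f \<in> carrier G \<times> carrier G \<rightarrow>\<^sub>E carrier A" and h: "h \<in> carrier G \<times> carrier G \<rightarrow>\<^sub>E carrier A"
    using fh by (auto simp: ml_cocycles_def)
  interpret s: mla_morphism G ?E s
    using s E mult_lie_algebra_axioms by (simp add: mla_morphism_def mla_morphism_axioms_def)
  \<comment> \<open>The first coordinate of the section. Comparing first coordinates in the
    homomorphism laws of \<open>s\<close> expresses \<open>f\<close> and \<open>h\<close> through
    \<open>t\<close>.\<close>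
  define t where "t = (\<lambda>x. fst (s x))"
  have st: "s x = (t x, x)" if "x \<in> carrier G" for x
    using sec[OF that] by (simp add: t_def prod_eq_iff)
  have tA [simp]: "t x \<in> carrier A" if "x \<in> carrier G" for x
    using s.hom_closed[OF that] st[OF that] by simp
  have t1: "t \<one> = \<one>\<^bsub>A\<^esub>"
    using s.hom_one st[of \<one>] by simp
  have tm: "t (x \<otimes> y) = t x \<otimes>\<^bsub>A\<^esub> t y \<otimes>\<^bsub>A\<^esub> f (x, y)" if "x \<in> carrier G" "y \<in> carrier G" for x y
    using s.hom_mult[OF that] that by (simp add: st)
  have ts: "t (x \<star> y) = h (x, y)" if "x \<in> carrier G" "y \<in> carrier G" for x y
    using s.hom_star[OF that] that by (simp add: st)
  \<comment> \<open>Solving \<open>tm\<close> for \<open>f\<close> gives the coboundary formula with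
    \<open>t\<close> inverted, and \<open>h (x, y) = t (x \<star> y)\<close> fits the inverse in the
    second component.\<close>
  define g where "g = (\<lambda>x. inv\<^bsub>A\<^esub> t x)"
  have "f = fst (ml_coboundary G A g)"
  proof (rule PiE_ext[OF f])
    show "fst (ml_coboundary G A g) \<in> carrier G \<times> carrier G \<rightarrow>\<^sub>E carrier A"
      by (auto simp: ml_coboundary_def g_def)
    fix u assume "u \<in> carrier G \<times> carrier G"
    then obtain x y where u: "u = (x, y)" "x \<in> carrier G" "y \<in> carrier G"
      by blast
    have fA: "f (x, y) \<in> carrier A"
      using f u by blast
    show "f u = fst (ml_coboundary G A g) u"
      using u fA A.inv_mult_cancel(1)[of "t x \<otimes>\<^bsub>A\<^esub> t y" "f (x, y)"]
      by (simp add: ml_coboundary_def g_def tm A.inv_mult)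
  qed
  moreover have "h = snd (ml_coboundary G A g)"
  proof (rule PiE_ext[OF h])
    show "snd (ml_coboundary G A g) \<in> carrier G \<times> carrier G \<rightarrow>\<^sub>E carrier A"
      by (auto simp: ml_coboundary_def g_def)
    fix u assume u: "u \<in> carrier G \<times> carrier G"
    then have "h u \<in> carrier A"
      using h by blast
    with u show "h u = snd (ml_coboundary G A g) u"
      by (auto simp: ml_coboundary_def g_def ts)
  qed
  ultimately have "(f, h) = ml_coboundary G A g"
    by (simp add: prod_eq_iff)
  moreover have "g \<in> carrier G \<rightarrow> carrier A" "g \<one> = \<one>\<^bsub>A\<^esub>"
    by (auto simp: g_def t1)
  ultimately show ?thesis
    unfolding ml_B2_def by blast
qed

lemma trivial_ml_H2:
  assumes A: "comm_group A"
  shows "trivial_group (ml_H2 G A)"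
proof -
  \<comment> \<open>Equality makes \<open>ml_H2 G A\<close> the quotient of a group by its whole
    carrier, and also supplies the group structure through \<open>ml_Z2_group\<close>.\<close>
  have Z2: "ml_cocycles G A = ml_B2 G A"
  proof
    show "ml_cocycles G A \<subseteq> ml_B2 G A"
      using cocycle_coboundary[OF A] by auto
    show "ml_B2 G A \<subseteq> ml_cocycles G A"
      using ml_coboundary_cocycle[OF A] by (auto simp: ml_B2_def)
  qed
  then have "ml_B2 G A = carrier (ml_Z2 G A)"
    by (simp add: ml_Z2_def)
  then show ?thesis
    using group.trivial_group_Mod_carrier[OF ml_Z2_group[OF A Z2]] by (simp add: ml_H2_def)
qed

end

theorem theorem4p25:
  fixes G :: "'a mla"
  assumes "mult_lie_algebra G"
    and "finite (carrier G)"
    and "mla_perfect G"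
    and "trivial_group (schur_multiplier G)"
  shows "(\<forall>A :: 'c monoid. comm_group A \<longrightarrow> trivial_group (ml_H2 G A)) \<and>
         (\<forall>N. central_ideal N G \<longrightarrow>
            sub_mla G N \<cong>\<^sub>M schur_multiplier (quot_mla G N) \<and>
            stem_cover N G (\<lambda>x. N #>\<^bsub>G\<^esub> x) (quot_mla G N) \<and>
            mla_cover G (quot_mla G N))"
proof -
  interpret superperfect_mla G
    using assms by (simp add: superperfect_mla_def superperfect_mla_axioms_def)
  show ?thesis
    unfolding mla_cover_def
    using trivial_ml_H2 central_quotient_multiplier central_quotient_stem_cover by blast
qed

end
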